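(* Let $E$ be a real uniformly smooth and 2-uniformly convex Banach space with dual $E^*$, and let $C$ be a nonempty closed convex subset of $E$. Let $A_1,\dots,A_M : C\to E^*$ be mappings and $\alpha>0$ a constant such that for each $i$: (V1) $A_i$ is $\alpha$-inverse strongly monotone; (V2) $VI(A_i,C)\neq\emptyset$; (V3) $\|A_iy\|\le\|A_iy-A_iu\|$ for all $y\in C$ and $u\in VI(A_i,C)$. Let $f_1,\dots,f_K: C\times C\to\mathbb{R}$ be bifunctions such that for each $k$: (A1) $f_k(x,x)=0$ for all $x\in C$; (A2) $f_k(x,y)+f_k(y,x)\le 0$ for all $x,y\in C$; (A3) $\limsup_{t\to0^+}f_k(tz+(1-t)x,y)\le f_k(x,y)$ for all $x,y,z\in C$; (A4) for each $x\in C$, $f_k(x,\cdot)$ is convex and lower semicontinuous. Let $S_1,\dots,S_N: C\to C$ be closed and quasi $\phi$-nonexpansive mappings. Suppose that $$F=\Big(\bigcap_{i=1}^M VI(A_i,C)\Big)\cap\Big(\bigcap_{j=1}^N F(S_j)\Big)\cap\Big(\bigcap_{k=1}^K EP(f_k)\Big)$$ is nonempty. Let $\{\alpha_{n,j}\}$ ($0\le j\le N$), $\{\lambda_n\},\{r_n\}$ be real sequences with $$0\le\alpha_{n,j}\le1,\quad \sum_{j=0}^N\alpha_{n,j}=1,\quad \liminf_{n\to\infty}\alpha_{n,0}\alpha_{n,j}>0\ (j=1,\dots,N),\quad \lambda_n\in[a,b],\quad r_n\ge d$$ for some $a,b\in(0,\alpha c^2/2)$ and $d>0$, where $1/c$ is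 the 2-uniform convexity constant of $E$. Let $x_0\in C$, $C_0=C$, and for $n\ge0$ define $$\begin{aligned} &y_n^i=\Pi_C\big(J^{-1}(Jx_n-\lambda_nA_ix_n)\big),\quad i=1,\dots,M,\\ &i_n\in\arg\max\{\|y_n^i-x_n\|:1\le i\le M\},\quad \bar y_n=y_n^{i_n},\\ &z_n=J^{-1}\Big(\alpha_{n,0}Jx_n+\sum_{j=1}^N\alpha_{n,j}JS_j\bar y_n\Big),\\ &u_n^k=T_{r_n}^kz_n,\quad k=1,\dots,K,\\ &k_n\in\arg\max\{\|u_n^k-x_n\|:1\le k\le K\},\quad \bar u_n=u_n^{k_n},\\ &C_{n+1}=\{z\in C_n:\phi(z,\bar u_n)\le\phi(z,x_n)\},\\ &x_{n+1}=\Pi_{C_{n+1}}x_0. \end{aligned}$$ Then $\{x_n\}$ converges strongly to $\Pi_Fx_0$.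
   Context: $J:E\to E^*$ is the normalized duality mapping, $\langle Jx,x\rangle=\|x\|^2=\|Jx\|^2$ (single-valued and bijective here). The 2-uniform convexity constant $1/c$ of $E$: $c$ is the best (largest) constant in $(0,1]$ such that $\|x-y\|\le\frac{2}{c^2}\|Jx-Jy\|$ for all $x,y\in E$. Lyapunov functional: $\phi(x,y)=\|x\|^2-2\langle x,Jy\rangle+\|y\|^2$ for $x,y\in E$. For a nonempty closed convex $D\subset E$, the generalized projection $\Pi_D:E\to D$ is $\Pi_D(x)=\arg\min_{y\in D}\phi(y,x)$ (the unique minimizer). For $A:C\to E^*$: $A$ is $\alpha$-inverse strongly monotone if $\langle Ax-Ay,x-y\rangle\ge\alpha\|Ax-Ay\|^2$ for all $x,y\in C$; $VI(A,C)=\{p^*\in C:\langle Ap^*,p-p^*\rangle\ge0\ \forall p\in C\}$. For $f:C\times C\to\mathbb{R}$: $EP(f)=\{\hat x\in C: f(\hat x,y)\ge0\ \forall y\in C\}$. For $r>0$ and $x\in E$, $T_r^kx$ denotes the unique $z\in C$ with $f_k(z,y)+\frac1r\langle y-z,Jz-Jx\rangle\ge0$ for all $y\in C$ (existence and uniqueness hold under (A1)-(A4)). For $T:C\to C$: $F(T)$ is the fixed point set. $T$ is closed if $x_n\in C$, $x_n\to x$ and $Tx_n\to y$ imply $Tx=y$. $T$ is quasi $\phi$-nonexpansive if $F(T)\ne\emptyset$ and $\phi(p,Tx)\le\phi(p,x)$ for all $p\in F(T)$, $x\in C$. Ties in the $\arg\max$ are broken arbitrarily. *)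

theory Defs
  imports "HOL-Analysis.Analysis"
begin

section \<open>Geometry of the space\<close>

text \<open>The difference quotients of the norm converge as \<open>t \<rightarrow> 0\<close>, uniformly in
  unit vectors \<open>x\<close> and \<open>y\<close>.\<close>

definition uniformly_smooth :: "'a::real_normed_vector itself \<Rightarrow> bool" where
  "uniformly_smooth _ \<longleftrightarrow>
     (\<exists>g. uniform_limit (sphere 0 1 \<times> sphere (0::'a) 1)
            (\<lambda>t (x, y). (norm (x + t *\<^sub>R y) - norm x) / t) g (at (0::real)))"

text \<open>The infimum is taken in \<^typ>\<open>ereal\<close>, so that it is \<open>\<infinity>\<close> where the index set is
  empty (only possible for the zero space when \<open>0 < \<epsilon> \<le> 2\<close>).\<close>

definition convexity_modulus :: "'a::real_normed_vector itself \<Rightarrow> real \<Rightarrow> ereal" where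
  "convexity_modulus _ \<epsilon> =
     (INF (x, y) \<in> {(x::'a, y). norm x = 1 \<and> norm y = 1 \<and> \<epsilon> \<le> norm (x - y)}.
        ereal (1 - norm ((1/2) *\<^sub>R (x + y))))"

definition two_uniformly_convex :: "'a::real_normed_vector itself \<Rightarrow> bool" where
  "two_uniformly_convex E \<longleftrightarrow>
     (\<exists>k>0. \<forall>\<epsilon>\<in>{0<..2}. ereal (k * \<epsilon>\<^sup>2) \<le> convexity_modulus E \<epsilon>)"

text \<open>Single-valuedness and bijectivity of \<open>duality_map\<close>, uniqueness of the minimizer
  in \<open>gen_proj\<close> and of the point in \<open>resolvent\<close> are consequences of the standing
  hypotheses, not part of these definitions.\<close>

definition duality_map :: "'a::real_normed_vector \<Rightarrow> 'a \<Rightarrow>\<^sub>L real" where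
  "duality_map x = (THE g. blinfun_apply g x = (norm x)\<^sup>2 \<and> (norm g)\<^sup>2 = (norm x)\<^sup>2)"

definition inv_duality_map :: "('a::real_normed_vector \<Rightarrow>\<^sub>L real) \<Rightarrow> 'a" where
  "inv_duality_map = inv duality_map"

text \<open>The largest admissible \<open>c\<close>; it is \<open>1 / c\<close> that is called the 2-uniform
  convexity constant.\<close>

definition convexity_c :: "'a::real_normed_vector itself \<Rightarrow> real" where
  "convexity_c _ =
     (GREATEST c. 0 < c \<and> c \<le> 1 \<and>
        (\<forall>x y::'a. norm (x - y) \<le> 2 / c\<^sup>2 * norm (duality_map x - duality_map y)))"

definition lyapunov :: "'a::real_normed_vector \<Rightarrow> 'a \<Rightarrow> real" where
  "lyapunov x y = (norm x)\<^sup>2 - 2 * blinfun_apply (duality_map y) x + (norm y)\<^sup>2"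

definition gen_proj :: "'a::real_normed_vector set \<Rightarrow> 'a \<Rightarrow> 'a" where
  "gen_proj D x = arg_min_on (\<lambda>y. lyapunov y x) D"


section \<open>Variational inequalities, equilibrium problems, fixed points\<close>

text \<open>Operators, bifunctions and maps given on \<open>C\<close> are total functions whose values
  outside \<open>C\<close> are irrelevant.\<close>

definition inverse_strongly_monotone_on ::
  "'a::real_normed_vector set \<Rightarrow> real \<Rightarrow> ('a \<Rightarrow> 'a \<Rightarrow>\<^sub>L real) \<Rightarrow> bool" where
  "inverse_strongly_monotone_on C \<alpha> A \<longleftrightarrow>
     (\<forall>x\<in>C. \<forall>y\<in>C. blinfun_apply (A x - A y) (x - y) \<ge> \<alpha> * (norm (A x - A y))\<^sup>2)"

definition VI :: "('a::real_normed_vector \<Rightarrow> 'a \<Rightarrow>\<^sub>L real) \<Rightarrow> 'a set \<Rightarrow> 'a set" where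
  "VI A C = {p \<in> C. \<forall>q\<in>C. blinfun_apply (A p) (q - p) \<ge> 0}"

definition EP :: "('a \<Rightarrow> 'a \<Rightarrow> real) \<Rightarrow> 'a set \<Rightarrow> 'a set" where
  "EP f C = {x \<in> C. \<forall>y\<in>C. f x y \<ge> 0}"

definition resolvent ::
  "'a::real_normed_vector set \<Rightarrow> ('a \<Rightarrow> 'a \<Rightarrow> real) \<Rightarrow> real \<Rightarrow> 'a \<Rightarrow> 'a" where
  "resolvent C f r x =
     (THE z. z \<in> C \<and>
        (\<forall>y\<in>C. f z y + (1 / r) * blinfun_apply (duality_map z - duality_map x) (y - z) \<ge> 0))"

definition lower_semicontinuous_on :: "'a::topological_space set \<Rightarrow> ('a \<Rightarrow> real) \<Rightarrow> bool" where
  "lower_semicontinuous_on C g \<longleftrightarrow>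
     (\<forall>x\<in>C. ereal (g x) \<le> Liminf (at x within C) (\<lambda>y. ereal (g y)))"

definition Fix :: "('a \<Rightarrow> 'a) \<Rightarrow> 'a set \<Rightarrow> 'a set" where
  "Fix T C = {x \<in> C. T x = x}"

definition closed_operator_on :: "'a::topological_space set \<Rightarrow> ('a \<Rightarrow> 'a) \<Rightarrow> bool" where
  "closed_operator_on C T \<longleftrightarrow>
     (\<forall>u x y. (\<forall>n. u n \<in> C) \<longrightarrow> u \<longlonglongrightarrow> x \<longrightarrow> (\<lambda>n. T (u n)) \<longlonglongrightarrow> y \<longrightarrow> T x = y)"

definition quasi_phi_nonexpansive_on :: "'a::real_normed_vector set \<Rightarrow> ('a \<Rightarrow> 'a) \<Rightarrow> bool" where
  "quasi_phi_nonexpansive_on C T \<longleftrightarrow>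
     Fix T C \<noteq> {} \<and> (\<forall>p\<in>Fix T C. \<forall>x\<in>C. lyapunov p (T x) \<le> lyapunov p x)"

end

theory Submission
  imports Defs
begin

text \<open>The midpoint inequality \<open>\<parallel>(x + y)/2\<parallel>\<^sup>2 \<le> (\<parallel>x\<parallel>\<^sup>2 + \<parallel>y\<parallel>\<^sup>2)/2 - \<kappa> \<parallel>x - y\<parallel>\<^sup>2\<close> extracted from 2-uniform
  convexity replaces all weak compactness: minimising sequences and nested families of closed convex
  sets give Cauchy sequences. It yields \<open>2\<kappa> \<parallel>x - y\<parallel>\<^sup>2 \<le> \<phi>(x, y)\<close>, so \<open>\<phi>(x\<^sub>n, y\<^sub>n) \<rightarrow> 0\<close> forces \<open>x\<^sub>n - y\<^sub>n \<rightarrow> 0\<close>.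

  The iterates are Cauchy because \<open>\<phi>(x\<^sub>n, x\<^sub>0)\<close> is increasing and bounded. The constraint defining \<open>C\<^sub>n\<^sub>+\<^sub>1\<close>
  then forces the resolvent points to the same limit, hence \<open>\<phi>(p, x\<^sub>n) - \<phi>(p, u\<^sub>n) \<rightarrow> 0\<close> for \<open>p \<in> F\<close>. That
  difference dominates \<open>\<parallel>A x\<^sub>n - A p\<parallel>\<^sup>2\<close> as well as the terms \<open>\<phi>(z\<^sub>n, x\<^sub>n)\<close> and \<open>\<phi>(z\<^sub>n, S\<^sub>j y\<^sub>n)\<close>, by the exact identity
  \<open>\<phi>(p, z) = \<Sum> \<beta>\<^sub>j (\<phi>(p, w\<^sub>j) - \<phi>(z, w\<^sub>j))\<close> for \<open>J z = \<Sum> \<beta>\<^sub>j J w\<^sub>j\<close>, so that no uniform convexity of the dual is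
  needed. The limit is the minimiser over every \<open>C\<^sub>n\<close>, which makes it \<open>\<Pi>\<^sub>F x\<^sub>0\<close> without knowing that \<open>F\<close>
  is closed and convex.\<close>

section \<open>The norm and the duality map\<close>

text \<open>On the unit sphere this is the modulus estimate. In general both vectors are split into
  length and direction: the angle loses through the modulus, the difference of lengths through
  convexity of the square.\<close>

lemma midpoint_strongly_convex:
  assumes "two_uniformly_convex TYPE('a::real_normed_vector)"
  shows "\<exists>\<kappa>>0. \<forall>x y::'a. (norm ((1/2) *\<^sub>R (x + y)))\<^sup>2
           \<le> ((norm x)\<^sup>2 + (norm y)\<^sup>2) / 2 - \<kappa> * (norm (x - y))\<^sup>2"
proof -
  obtain k where k: "k > 0" "\<And>e. e \<in> {0<..2} \<Longrightarrow> ereal (k * e\<^sup>2) \<le> convexity_modulus TYPE('a) e"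
    using assms unfolding two_uniformly_convex_def by blast
  have unit: "norm ((1/2) *\<^sub>R (x + y)) \<le> 1 - k * (norm (x - y))\<^sup>2"
    if "norm x = 1" "norm y = 1" for x y :: 'a
  proof (cases "x = y")
    case True
    then show ?thesis using that by (simp add: scaleR_add_left[symmetric])
  next
    case False
    have "norm (x - y) \<le> 2"
      using norm_triangle_ineq4[of x y] that by simp
    then have "ereal (k * (norm (x - y))\<^sup>2) \<le> convexity_modulus TYPE('a) (norm (x - y))"
      using False by (intro k(2)) auto
    also have "\<dots> \<le> ereal (1 - norm ((1/2) *\<^sub>R (x + y)))"
      unfolding convexity_modulus_def by (rule INF_lower2[of "(x, y)"]) (use that in auto)
    finally show ?thesis by simp
  qed
  \<comment> \<open>The cap \<open>1/8\<close> makes the length part of \<open>norm (x - y)\<close>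
    fit into \<open>(s - t)\<^sup>2 / 4\<close>; the cap \<open>k/2\<close> makes the angular part
    fit into \<open>t\<^sup>2 * q\<close>.\<close>
  define \<kappa> where "\<kappa> = min (1/8) (k/2)"
  have \<kappa>: "\<kappa> > 0" "\<kappa> \<le> 1/8" "\<kappa> \<le> k/2"
    using k(1) by (auto simp: \<kappa>_def)
  have ordered: "(norm ((1/2) *\<^sub>R (x + y)))\<^sup>2
      \<le> ((norm x)\<^sup>2 + (norm y)\<^sup>2) / 2 - \<kappa> * (norm (x - y))\<^sup>2"
    if le: "norm y \<le> norm x" for x y :: 'a
  proof (cases "y = 0")
    case True
    have "\<kappa> * (norm x)\<^sup>2 \<le> 1/8 * (norm x)\<^sup>2"
      by (intro mult_right_mono \<kappa>) simp
    then have "(norm x)\<^sup>2 / 4 \<le> (norm x)\<^sup>2 / 2 - \<kappa> * (norm x)\<^sup>2"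
      using zero_le_power2[of "norm x"] by linarith
    then show ?thesis using True by (simp add: power_divide)
  next
    case False
    define s t where "s = norm x" and "t = norm y"
    have st: "0 < t" "t \<le> s" using False le by (auto simp: s_def t_def)
    define x' y' where "x' = x /\<^sub>R s" and "y' = y /\<^sub>R t"
    have xy: "x = s *\<^sub>R x'" "y = t *\<^sub>R y'" and n1: "norm x' = 1" "norm y' = 1"
      using st by (simp_all add: x'_def y'_def flip: s_def t_def)
    define e where "e = norm (x' - y')"
    define q where "q = k * e\<^sup>2"
    have u: "norm ((1/2) *\<^sub>R (x' + y')) \<le> 1 - q"
      using unit[OF n1] by (simp add: q_def e_def)
    have q: "0 \<le> q" "q \<le> 1"
      using k(1) order_trans[OF norm_ge_zero u] by (auto simp: q_def)
    have "(1/2) *\<^sub>R (x + y) = t *\<^sub>R ((1/2) *\<^sub>R (x' + y')) + ((s - t) / 2) *\<^sub>R x'"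
      unfolding xy by (simp add: algebra_simps diff_divide_distrib)
    then have "norm ((1/2) *\<^sub>R (x + y))
        \<le> norm (t *\<^sub>R ((1/2) *\<^sub>R (x' + y'))) + norm (((s - t) / 2) *\<^sub>R x')"
      using norm_triangle_ineq by metis
    also have "\<dots> = t * norm ((1/2) *\<^sub>R (x' + y')) + (s - t) / 2"
      using st n1 by (simp del: scaleR_add_right)
    also have "\<dots> \<le> t * (1 - q) + (s - t) / 2"
      using u st by (intro add_right_mono mult_left_mono) auto
    also have "\<dots> = (s + t) / 2 - t * q"
      by (simp add: algebra_simps diff_divide_distrib add_divide_distrib)
    finally have m: "norm ((1/2) *\<^sub>R (x + y)) \<le> (s + t) / 2 - t * q" .
    have "x - y = (s - t) *\<^sub>R x' + t *\<^sub>R (x' - y')"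
      unfolding xy by (simp add: algebra_simps)
    then have "norm (x - y) \<le> norm ((s - t) *\<^sub>R x') + norm (t *\<^sub>R (x' - y'))"
      using norm_triangle_ineq by metis
    also have "\<dots> = (s - t) + t * e"
      using st n1 by (simp add: e_def)
    finally have "(norm (x - y))\<^sup>2 \<le> ((s - t) + t * e)\<^sup>2"
      by (intro power_mono) auto
    also have "\<dots> \<le> 2 * (s - t)\<^sup>2 + 2 * (t * e)\<^sup>2"
      using sum_squares_bound[of "s - t" "t * e"] by (simp add: power2_sum)
    finally have D: "(norm (x - y))\<^sup>2 \<le> 2 * (s - t)\<^sup>2 + 2 * (t * e)\<^sup>2" .
    have "\<kappa> * (norm (x - y))\<^sup>2 \<le> \<kappa> * (2 * (s - t)\<^sup>2) + \<kappa> * (2 * (t * e)\<^sup>2)"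
      using mult_left_mono[OF D, of \<kappa>] \<kappa>(1) by (simp add: distrib_left)
    also have "\<dots> \<le> 1/8 * (2 * (s - t)\<^sup>2) + k/2 * (2 * (t * e)\<^sup>2)"
      by (intro add_mono mult_right_mono \<kappa>) auto
    also have "\<dots> = (s - t)\<^sup>2 / 4 + t\<^sup>2 * q"
      by (simp add: q_def power_mult_distrib)
    finally have E: "\<kappa> * (norm (x - y))\<^sup>2 \<le> (s - t)\<^sup>2 / 4 + t\<^sup>2 * q" .
    have "(norm ((1/2) *\<^sub>R (x + y)))\<^sup>2 \<le> ((s + t) / 2 - t * q)\<^sup>2"
      using m by (intro power_mono) auto
    also have "\<dots> = ((s + t) / 2)\<^sup>2 - (s + t) * t * q + t\<^sup>2 * (q * q)"
      by (simp add: power2_eq_square field_simps)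
    \<comment> \<open>By \<open>t \<le> s\<close> the linear gain is at least
      \<open>2 * t\<^sup>2 * q\<close>, and by \<open>q \<le> 1\<close> the quadratic error is at
      most \<open>t\<^sup>2 * q\<close>, so one copy of \<open>t\<^sup>2 * q\<close>
      survives.\<close>
    also have "\<dots> \<le> ((s + t) / 2)\<^sup>2 - (t + t) * t * q + t\<^sup>2 * (1 * q)"
      using st q by (intro add_mono diff_mono mult_right_mono mult_left_mono) auto
    also have "\<dots> = (s\<^sup>2 + t\<^sup>2) / 2 - ((s - t)\<^sup>2 / 4 + t\<^sup>2 * q)"
      by (simp add: power2_eq_square field_simps)
    finally show ?thesis using E by (simp add: s_def t_def)
  qed
  show ?thesis
  proof (intro exI[of _ \<kappa>] conjI allI \<kappa>(1))
    fix x y :: 'a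
    show "(norm ((1/2) *\<^sub>R (x + y)))\<^sup>2
      \<le> ((norm x)\<^sup>2 + (norm y)\<^sup>2) / 2 - \<kappa> * (norm (x - y))\<^sup>2"
      using ordered[of y x] ordered[of x y]
      by (cases "norm y \<le> norm x") (auto simp: add.commute norm_minus_commute)
  qed
qed

text \<open>Uniform smoothness gives limits along unit directions, and scaling extends them to all
  directions. The limit is odd because it is two-sided, and subadditive because the norm is convex,
  hence linear.\<close>

lemma norm_gateaux_derivative:
  fixes x :: "'a::real_normed_vector"
  assumes "uniformly_smooth TYPE('a)" and x: "norm x = 1"
  obtains g :: "'a \<Rightarrow>\<^sub>L real"
    where "\<And>y. ((\<lambda>t. (norm (x + t *\<^sub>R y) - norm x) / t) \<longlongrightarrow> blinfun_apply g y) (at 0)"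
proof -
  let ?q = "\<lambda>y t. (norm (x + t *\<^sub>R y) - norm x) / t"
  obtain G where G: "uniform_limit (sphere 0 1 \<times> sphere (0::'a) 1)
      (\<lambda>t (x, y). (norm (x + t *\<^sub>R y) - norm x) / t) G (at (0::real))"
    using assms unfolding uniformly_smooth_def by blast
  have scale: "(?q (s *\<^sub>R y) \<longlongrightarrow> s * l) (at 0)" if "(?q y \<longlongrightarrow> l) (at 0)" for s y l
  proof (cases "s = 0")
    case False
    have "((\<lambda>t. ?q y (s * t)) \<longlongrightarrow> l) (at 0)"
    proof (rule filterlim_compose[OF that])
      have "((\<lambda>t. s * t) \<longlongrightarrow> s * 0) (at 0)" by (intro tendsto_intros)
      then show "filterlim (\<lambda>t. s * t) (at 0) (at 0)"
        using False by (auto simp: filterlim_at eventually_at_filter)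
    qed
    then have "((\<lambda>t. s * ?q y (s * t)) \<longlongrightarrow> s * l) (at 0)" by (intro tendsto_intros)
    then show ?thesis using False by (simp add: mult.commute)
  qed simp
  have ex: "\<exists>l. (?q y \<longlongrightarrow> l) (at 0)" for y
  proof (cases "y = 0")
    case False
    have "(x, sgn y) \<in> sphere 0 1 \<times> sphere 0 1" using x False by (simp add: norm_sgn)
    from tendsto_uniform_limitI[OF G this] have "(?q (sgn y) \<longlongrightarrow> G (x, sgn y)) (at 0)" by simp
    from scale[OF this, of "norm y"] show ?thesis
      using False by (auto simp: sgn_div_norm)
  qed auto
  define D where "D y = Lim (at 0) (?q y)" for y
  have D: "(?q y \<longlongrightarrow> D y) (at 0)" for y
    using ex[of y] tendsto_Lim[of "at (0::real)" "?q y"] unfolding D_def by auto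
  have D_scale: "D (s *\<^sub>R y) = s * D y" for s y
    using tendsto_unique[OF _ D scale[OF D]] by auto
  have right: "(?q y \<longlongrightarrow> D y) (at_right 0)" for y
    using D filterlim_at_split by blast
  have D_sub: "D (y + z) \<le> D y + D z" for y z
  proof (rule tendsto_le[OF _ _ right])
    show "((\<lambda>t. 1/2 * ?q (2 *\<^sub>R y) t + 1/2 * ?q (2 *\<^sub>R z) t) \<longlongrightarrow> D y + D z) (at_right 0)"
      using tendsto_add[OF tendsto_mult[OF tendsto_const[of "1/2"] right[of "2 *\<^sub>R y"]]
        tendsto_mult[OF tendsto_const[of "1/2"] right[of "2 *\<^sub>R z"]]] by (simp add: D_scale)
    show "\<forall>\<^sub>F t in at_right 0. ?q (y + z) t \<le> 1/2 * ?q (2 *\<^sub>R y) t + 1/2 * ?q (2 *\<^sub>R z) t"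
      unfolding eventually_at_filter
    proof (intro always_eventually allI impI)
      fix t :: real assume "t \<in> {0<..}"
      have "x + t *\<^sub>R (y + z) = (1/2) *\<^sub>R (x + t *\<^sub>R (2 *\<^sub>R y)) + (1/2) *\<^sub>R (x + t *\<^sub>R (2 *\<^sub>R z))"
        by (simp add: algebra_simps flip: scaleR_add_left)
      then have "norm (x + t *\<^sub>R (y + z))
          \<le> norm ((1/2) *\<^sub>R (x + t *\<^sub>R (2 *\<^sub>R y))) + norm ((1/2) *\<^sub>R (x + t *\<^sub>R (2 *\<^sub>R z)))"
        using norm_triangle_ineq by metis
      also have "\<dots> = 1/2 * norm (x + t *\<^sub>R (2 *\<^sub>R y)) + 1/2 * norm (x + t *\<^sub>R (2 *\<^sub>R z))"
        by (simp only: norm_scaleR)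
      finally have "norm (x + t *\<^sub>R (y + z)) - norm x
          \<le> 1/2 * (norm (x + t *\<^sub>R (2 *\<^sub>R y)) - norm x) + 1/2 * (norm (x + t *\<^sub>R (2 *\<^sub>R z)) - norm x)"
        by argo
      from divide_right_mono[OF this, of t] \<open>t \<in> {0<..}\<close>
      show "?q (y + z) t \<le> 1/2 * ?q (2 *\<^sub>R y) t + 1/2 * ?q (2 *\<^sub>R z) t"
        by (simp add: add_divide_distrib)
    qed
  qed simp
  have D_minus: "D (- y) = - D y" for y using D_scale[of "-1" y] by simp
  have D_add: "D (y + z) = D y + D z" for y z
    using D_sub[of y z] D_sub[of "y + z" "- z"] D_minus[of z] by simp
  have D_le: "D y \<le> norm y" for y
  proof (rule tendsto_upperbound[OF right])
    show "\<forall>\<^sub>F t in at_right 0. ?q y t \<le> norm y"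
      unfolding eventually_at_filter
    proof (intro always_eventually allI impI)
      fix t :: real assume t: "t \<in> {0<..}"
      then show "?q y t \<le> norm y"
        using norm_triangle_ineq[of x "t *\<^sub>R y"] by (simp add: field_simps)
    qed
  qed simp
  have "bounded_linear D"
    by (rule bounded_linear_intro[where K = 1])
       (use D_add D_scale D_le D_le[of "- y" for y] D_minus in \<open>auto simp: abs_le_iff\<close>)
  then have "blinfun_apply (Blinfun D) = D" by (rule bounded_linear_Blinfun_apply)
  then show ?thesis using that[of "Blinfun D"] D by simp
qed

lemma norm_blinfun_le_unit:
  fixes g :: "'a::real_normed_vector \<Rightarrow>\<^sub>L real"
  assumes "B \<ge> 0" "\<And>h. norm h = 1 \<Longrightarrow> blinfun_apply g h \<le> B"
  shows "norm g \<le> B"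
proof (rule norm_blinfun_bound[OF assms(1)])
  fix h
  have le: "blinfun_apply g h \<le> B * norm h" for h
  proof (cases "h = 0")
    case False
    have "blinfun_apply g h = norm h * blinfun_apply g (sgn h)"
      using False by (simp add: sgn_div_norm blinfun.scaleR_right)
    also have "\<dots> \<le> norm h * B"
      using False by (intro mult_left_mono assms(2)) (auto simp: norm_sgn)
    finally show ?thesis by (simp add: mult.commute)
  qed simp
  show "norm (blinfun_apply g h) \<le> B * norm h"
    using le[of h] le[of "- h"] by (simp add: blinfun.minus_right abs_le_iff)
qed

lemma blinfun_le_norm: "blinfun_apply g x \<le> norm g * norm x"
  for g :: "'a::real_normed_vector \<Rightarrow>\<^sub>L real"
  using norm_blinfun[of g x] by simp

text \<open>The midpoint constant becomes a parameter, so that all later estimates share it.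
  Completeness enters through the sort \<open>banach\<close>.\<close>

locale smooth_convex_space =
  fixes E :: "'a::banach itself" and \<kappa> :: real
  assumes smooth: "uniformly_smooth TYPE('a)"
    and \<kappa>_pos: "\<kappa> > 0"
    and midpoint: "(norm ((1/2) *\<^sub>R (x + y :: 'a)))\<^sup>2
      \<le> ((norm x)\<^sup>2 + (norm y)\<^sup>2) / 2 - \<kappa> * (norm (x - y))\<^sup>2"
begin

text \<open>If \<open>h\<close> attains its norm at \<open>u\<close>, then
  \<open>h (u + t y) \<le> norm h * norm (u + t y)\<close> bounds \<open>h y\<close> by
  \<open>norm h\<close> times the difference quotient. In the limit
  \<open>h \<le> norm h * g\<close> pointwise, and replacing \<open>y\<close> by \<open>- y\<close>
  gives equality.\<close>

lemma support_functional_eq: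
  fixes u :: 'a and g h :: "'a \<Rightarrow>\<^sub>L real"
  assumes u: "norm u = 1"
    and g: "\<And>y. ((\<lambda>t. (norm (u + t *\<^sub>R y) - norm u) / t) \<longlongrightarrow> blinfun_apply g y) (at 0)"
    and h: "blinfun_apply h u = norm h"
  shows "h = norm h *\<^sub>R g"
proof -
  have le: "blinfun_apply h y \<le> norm h * blinfun_apply g y" for y
  proof (rule tendsto_lowerbound)
    show "((\<lambda>t. norm h * ((norm (u + t *\<^sub>R y) - norm u) / t)) \<longlongrightarrow> norm h * blinfun_apply g y)
      (at_right 0)"
      using g[of y] filterlim_at_split by (intro tendsto_intros) blast
    show "\<forall>\<^sub>F t in at_right 0. blinfun_apply h y \<le> norm h * ((norm (u + t *\<^sub>R y) - norm u) / t)"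
      unfolding eventually_at_filter
    proof (intro always_eventually allI impI)
      fix t :: real assume t: "t \<in> {0<..}"
      have "norm h + t * blinfun_apply h y \<le> norm h * norm (u + t *\<^sub>R y)"
        using blinfun_le_norm[of h "u + t *\<^sub>R y"]
        by (simp add: blinfun.add_right blinfun.scaleR_right h)
      then show "blinfun_apply h y \<le> norm h * ((norm (u + t *\<^sub>R y) - norm u) / t)"
        using t u by (simp add: field_simps)
    qed
  qed simp
  show ?thesis
  proof (rule blinfun_eqI)
    fix y
    show "blinfun_apply h y = blinfun_apply (norm h *\<^sub>R g) y"
      using le[of y] le[of "- y"] by (simp add: blinfun.minus_right blinfun.scaleR_left)
  qed
qed

text \<open>This justifies the \<open>THE\<close> in \<open>duality_map\<close>. The witness is the
  derivative of the norm at \<open>sgn x\<close>, scaled by \<open>norm x\<close>; any competitor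
  attains its norm there and is covered by \<open>support_functional_eq\<close>.\<close>

lemma duality_map_ex1:
  "\<exists>!g. blinfun_apply g x = (norm x)\<^sup>2 \<and> (norm g)\<^sup>2 = (norm (x::'a))\<^sup>2"
proof (cases "x = 0")
  case False
  define u where "u = sgn x"
  have u: "norm u = 1" "x = norm x *\<^sub>R u"
    using False by (auto simp: u_def norm_sgn sgn_div_norm)
  obtain g :: "'a \<Rightarrow>\<^sub>L real" where
    g: "\<And>y. ((\<lambda>t. (norm (u + t *\<^sub>R y) - norm u) / t) \<longlongrightarrow> blinfun_apply g y) (at 0)"
    using norm_gateaux_derivative[OF smooth u(1)] by blast
  have "\<forall>\<^sub>F t in at (0::real). \<bar>t\<bar> < 1"
    by (auto simp: eventually_at dist_real_def intro!: exI[of _ 1])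
  \<comment> \<open>Along \<open>u\<close> itself the norm is \<open>1 + t\<close> for small
    \<open>t\<close>, which pins down the value of the derivative at \<open>u\<close>.\<close>
  then have "\<forall>\<^sub>F t in at 0. (norm (u + t *\<^sub>R u) - norm u) / t = 1"
    using eventually_neq_at_within[of 0 0 UNIV]
  proof eventually_elim
    case (elim t)
    have "u + t *\<^sub>R u = (1 + t) *\<^sub>R u" by (simp add: scaleR_add_left)
    then show ?case using elim u by simp
  qed
  from tendsto_eventually[OF this] have gu: "blinfun_apply g u = 1"
    using tendsto_unique[OF _ g] by auto
  have "norm g \<le> 1"
  proof (rule norm_blinfun_le_unit)
    fix h :: 'a assume h: "norm h = 1"
    show "blinfun_apply g h \<le> 1"
    proof (rule tendsto_upperbound)
      show "((\<lambda>t. (norm (u + t *\<^sub>R h) - norm u) / t) \<longlongrightarrow> blinfun_apply g h) (at_right 0)"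
        using g[of h] filterlim_at_split by blast
      show "\<forall>\<^sub>F t in at_right 0. (norm (u + t *\<^sub>R h) - norm u) / t \<le> 1"
        unfolding eventually_at_filter
      proof (intro always_eventually allI impI)
        fix t :: real assume t: "t \<in> {0<..}"
        then show "(norm (u + t *\<^sub>R h) - norm u) / t \<le> 1"
          using norm_triangle_ineq[of u "t *\<^sub>R h"] h by (simp add: field_simps)
      qed
    qed simp
  qed simp
  moreover have "1 \<le> norm g"
    using blinfun_le_norm[of g u] gu u by simp
  ultimately have ng: "norm g = 1" by simp
  show ?thesis
  proof (rule ex1I)
    have "blinfun_apply g x = norm x"
      using gu u(2) by (metis blinfun.scaleR_right mult.right_neutral real_scaleR_def)
    then show "blinfun_apply (norm x *\<^sub>R g) x = (norm x)\<^sup>2 \<and> (norm (norm x *\<^sub>R g))\<^sup>2 = (norm x)\<^sup>2"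
      using ng by (simp add: blinfun.scaleR_left power2_eq_square)
    fix h :: "'a \<Rightarrow>\<^sub>L real"
    assume h: "blinfun_apply h x = (norm x)\<^sup>2 \<and> (norm h)\<^sup>2 = (norm x)\<^sup>2"
    then have nh: "norm h = norm x" by simp
    have "blinfun_apply h u = norm h"
      using h nh False by (simp add: u_def sgn_div_norm blinfun.scaleR_right power2_eq_square)
    from support_functional_eq[OF u(1) g this] show "h = norm x *\<^sub>R g"
      using nh by simp
  qed
qed auto

lemma duality_map_self: "blinfun_apply (duality_map x) x = (norm (x::'a))\<^sup>2"
  and norm_duality_map: "norm (duality_map x) = norm (x::'a)"
  using theI'[OF duality_map_ex1[of x]] unfolding duality_map_def by auto

lemma duality_map_eqI:
  assumes "blinfun_apply g x = (norm (x::'a))\<^sup>2" "norm g = norm x"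
  shows "duality_map x = g"
  using duality_map_ex1[of x] duality_map_self[of x] norm_duality_map[of x] assms by metis

lemma duality_map_scaleR: "duality_map (s *\<^sub>R x) = s *\<^sub>R duality_map (x::'a)"
  by (rule duality_map_eqI)
     (simp_all add: blinfun.scaleR_left blinfun.scaleR_right duality_map_self norm_duality_map
        power_mult_distrib flip: power2_eq_square mult.assoc)

lemma duality_map_le: "blinfun_apply (duality_map x) y \<le> norm x * norm (y::'a)"
  using blinfun_le_norm[of "duality_map x" y] by (simp add: norm_duality_map)

lemma norm_square_subgradient:
  "(norm (x::'a))\<^sup>2 + 2 * blinfun_apply (duality_map x) (y - x) \<le> (norm y)\<^sup>2"
  using duality_map_le[of x y] sum_squares_bound[of "norm x" "norm y"]
  by (simp add: blinfun.diff_right duality_map_self)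

text \<open>Uniformity of the limit provides one \<open>t\<close> that serves all unit directions
  \<open>h\<close> at once. For this \<open>t\<close> the quotient at \<open>v\<close> dominates
  \<open>J v h\<close>, and replacing \<open>v\<close> by \<open>u\<close> costs at most
  \<open>norm (v - u) / t\<close>; hence the radius \<open>e' * t\<close>.\<close>

lemma continuous_on_duality_map_sphere: "continuous_on (sphere 0 1) (duality_map :: 'a \<Rightarrow> _)"
  unfolding continuous_on_iff
proof (intro ballI allI impI)
  fix u :: 'a and e :: real
  assume "u \<in> sphere 0 1" and e: "e > 0"
  then have u: "norm u = 1" by simp
  define e' where "e' = e / 3"
  have e': "e' > 0" "e' + e' < e" using e by (auto simp: e'_def)
  let ?q = "\<lambda>y t. (norm (u + t *\<^sub>R y) - norm u) / t"
  obtain G where G: "uniform_limit (sphere 0 1 \<times> sphere (0::'a) 1)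
      (\<lambda>t (x, y). (norm (x + t *\<^sub>R y) - norm x) / t) G (at (0::real))"
    using smooth unfolding uniformly_smooth_def by blast
  obtain g :: "'a \<Rightarrow>\<^sub>L real" where g: "\<And>y. (?q y \<longlongrightarrow> blinfun_apply g y) (at 0)"
    using norm_gateaux_derivative[OF smooth u] by blast
  have Ju: "duality_map u = g"
    using support_functional_eq[OF u g, of "duality_map u"] u
    by (simp add: duality_map_self norm_duality_map)
  \<comment> \<open>The definition of smoothness leaves the uniform limit unspecified; uniqueness of
    pointwise limits identifies it with \<open>J\<close>.\<close>
  have GJ: "G (u, h) = blinfun_apply (duality_map u) h" if "norm h = 1" for h
    using tendsto_unique[OF _ tendsto_uniform_limitI[OF G, of "(u, h)"]] g[of h] u that Ju by simp
  have "\<forall>\<^sub>F t in at_right 0. \<forall>h\<in>sphere 0 1. ?q h t < blinfun_apply (duality_map u) h + e'"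
  proof -
    have "\<forall>\<^sub>F t in at 0. \<forall>p\<in>sphere 0 1 \<times> sphere (0::'a) 1.
        dist (case p of (x, y) \<Rightarrow> (norm (x + t *\<^sub>R y) - norm x) / t) (G p) < e'"
      using uniform_limitD[OF G, of "e'"] e' by simp
    then have "\<forall>\<^sub>F t in at 0. \<forall>h\<in>sphere 0 1. ?q h t < blinfun_apply (duality_map u) h + e'"
    proof eventually_elim
      case (elim t)
      show ?case
      proof
        fix h :: 'a assume "h \<in> sphere 0 1"
        then show "?q h t < blinfun_apply (duality_map u) h + e'"
          using elim[rule_format, of "(u, h)"] GJ[of h] u
          by (simp add: dist_real_def abs_less_iff)
      qed
    qed
    then show ?thesis by (simp add: eventually_at_split)
  qed
  then have "\<forall>\<^sub>F t in at_right 0. t > 0 \<and>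
      (\<forall>h\<in>sphere 0 1. ?q h t < blinfun_apply (duality_map u) h + e')"
    using eventually_at_right_less by eventually_elim auto
  from eventually_happens'[OF _ this] obtain t where t: "t > 0"
    and q: "\<And>h. norm h = 1 \<Longrightarrow> ?q h t < blinfun_apply (duality_map u) h + e'"
    by auto
  show "\<exists>d>0. \<forall>v\<in>sphere 0 1. dist v u < d \<longrightarrow> dist (duality_map v) (duality_map u) < e"
  proof (intro exI[of _ "e' * t"] conjI ballI impI)
    show "0 < e' * t" using e' t by simp
    fix v :: 'a assume "v \<in> sphere 0 1" and vu: "dist v u < e' * t"
    then have v: "norm v = 1" by simp
    have "norm (duality_map v - duality_map u) \<le> e' + e'"
    proof (rule norm_blinfun_le_unit)
      fix h :: 'a assume h: "norm h = 1"
      have "t * blinfun_apply (duality_map v) h \<le> norm (v + t *\<^sub>R h) - 1"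
        using duality_map_le[of v "v + t *\<^sub>R h"] v
        by (simp add: blinfun.add_right blinfun.scaleR_right duality_map_self)
      also have "\<dots> \<le> (norm (u + t *\<^sub>R h) - norm u) + norm (v - u)"
        using norm_triangle_ineq[of "u + t *\<^sub>R h" "v - u"] u by (simp add: algebra_simps)
      also have "\<dots> \<le> t * (blinfun_apply (duality_map u) h + e') + e' * t"
        using q[OF h] t vu by (intro add_mono) (auto simp: field_simps dist_norm)
      also have "\<dots> = t * (blinfun_apply (duality_map u) h + (e' + e'))"
        by (simp add: algebra_simps)
      finally show "blinfun_apply (duality_map v - duality_map u) h \<le> e' + e'"
        using t by (simp add: blinfun.diff_left)
    qed (use e' in simp)
    also have "\<dots> < e" using e' by simp
    finally show "dist (duality_map v) (duality_map u) < e" by (simp add: dist_norm)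
  qed
qed

text \<open>Away from 0, homogeneity \<open>J y = norm y * J (sgn y)\<close> reduces the claim to
  the sphere; at 0 it follows from \<open>norm (J y) = norm y\<close>.\<close>

lemma isCont_duality_map: "isCont duality_map (x::'a)"
proof (cases "x = 0")
  case True
  have "duality_map (0::'a) = 0" using norm_duality_map[of 0] by simp
  moreover have "((\<lambda>y::'a. norm (duality_map y)) \<longlongrightarrow> 0) (at 0)"
    unfolding norm_duality_map using tendsto_norm_zero[OF tendsto_ident_at] .
  ultimately show ?thesis
    unfolding isCont_def True by (simp add: tendsto_norm_zero_iff)
next
  case False
  have "continuous_on (- {0}) (\<lambda>y::'a. norm y *\<^sub>R duality_map (sgn y))"
  proof (rule continuous_on_scaleR[OF continuous_on_norm[OF continuous_on_id]],
      rule continuous_on_compose2[OF continuous_on_duality_map_sphere])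
    show "continuous_on (- {0}) (sgn :: 'a \<Rightarrow> 'a)"
      unfolding sgn_div_norm[abs_def] by (intro continuous_intros) auto
  qed (auto simp: norm_sgn split: if_splits)
  also have "(\<lambda>y::'a. norm y *\<^sub>R duality_map (sgn y)) = duality_map"
  proof
    fix y :: 'a
    show "norm y *\<^sub>R duality_map (sgn y) = duality_map y"
      using duality_map_scaleR[of "norm y" "sgn y"] by (cases "y = 0") (simp_all add: sgn_div_norm)
  qed
  finally show ?thesis
    using continuous_on_eq_continuous_at[of "- {0::'a}" duality_map] False by auto
qed

section \<open>The Lyapunov functional and strong monotonicity of the duality map\<close>

lemma tendsto_duality_map:
  "(X \<longlongrightarrow> (x::'a)) F \<Longrightarrow> ((\<lambda>n. duality_map (X n)) \<longlongrightarrow> duality_map x) F"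
  using isCont_tendsto_compose[OF isCont_duality_map] .

lemma tendsto_lyapunov:
  "(X \<longlongrightarrow> (x::'a)) F \<Longrightarrow> (Y \<longlongrightarrow> y) F \<Longrightarrow> ((\<lambda>n. lyapunov (X n) (Y n)) \<longlongrightarrow> lyapunov x y) F"
  unfolding lyapunov_def by (intro tendsto_intros tendsto_duality_map blinfun.tendsto)

lemma lyapunov_self: "lyapunov x (x::'a) = 0"
  by (simp add: lyapunov_def duality_map_self)

text \<open>The subgradient inequality of the squared norm at \<open>y\<close>, evaluated at the
  midpoint, is compared with the midpoint inequality.\<close>

lemma lyapunov_ge: "2 * \<kappa> * (norm (x - y :: 'a))\<^sup>2 \<le> lyapunov x y"
proof -
  have "(1/2) *\<^sub>R (x + y) - y = (1/2) *\<^sub>R (x - y)"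
    by (simp add: algebra_simps flip: scaleR_add_left)
  then have "(norm y)\<^sup>2 + blinfun_apply (duality_map y) (x - y) \<le> (norm ((1/2) *\<^sub>R (x + y)))\<^sup>2"
    using norm_square_subgradient[of y "(1/2) *\<^sub>R (x + y)"] by (simp add: blinfun.scaleR_right)
  with midpoint[of x y]
  have "blinfun_apply (duality_map y) x \<le> ((norm x)\<^sup>2 + (norm y)\<^sup>2) / 2 - \<kappa> * (norm (x - y))\<^sup>2"
    by (simp only: blinfun.diff_right duality_map_self)
  then show ?thesis unfolding lyapunov_def by argo
qed

lemma lyapunov_nonneg: "0 \<le> lyapunov x (y::'a)"
  using lyapunov_ge[of x y] \<kappa>_pos by (smt (verit) mult_nonneg_nonneg zero_le_power2)

text \<open>This plays the role of the law of cosines: the projection, resolvent and gradient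
  estimates below all come from it by dropping nonnegative terms.\<close>

lemma lyapunov_three_point:
  "lyapunov p z = lyapunov p u + lyapunov u z + 2 * blinfun_apply (duality_map u - duality_map z) (p - u)"
  for p u z :: 'a
  by (simp add: lyapunov_def blinfun.diff_left blinfun.diff_right duality_map_self algebra_simps)

lemma duality_map_strongly_monotone:
  "2 * \<kappa> * (norm (x - y))\<^sup>2 \<le> blinfun_apply (duality_map x - duality_map y) (x - y :: 'a)"
  using lyapunov_ge[of x y] lyapunov_ge[of y x]
  by (simp add: lyapunov_def blinfun.diff_left blinfun.diff_right duality_map_self norm_minus_commute)

lemma norm_diff_le_duality_map:
  "2 * \<kappa> * norm (x - y) \<le> norm (duality_map x - duality_map (y::'a))"
proof (cases "x = y")
  case False
  have "2 * \<kappa> * norm (x - y) * norm (x - y) \<le> norm (duality_map x - duality_map y) * norm (x - y)"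
    using order_trans[OF duality_map_strongly_monotone blinfun_le_norm]
    by (simp add: power2_eq_square mult.assoc)
  then show ?thesis using False by (simp add: mult_le_cancel_right)
qed simp

end

section \<open>Minimisation and the generalized projection\<close>

text \<open>The bound depends on the smaller index only. This is the form in which the midpoint
  inequality is used for minimising sequences, for growing intersections and for the
  iterates.\<close>

lemma Cauchy_if_square_bounded:
  fixes X :: "nat \<Rightarrow> 'a::real_normed_vector"
  assumes "\<kappa> > 0" and le: "\<And>m n. m \<le> n \<Longrightarrow> \<kappa> * (norm (X m - X n))\<^sup>2 \<le> b m" and b: "b \<longlonglongrightarrow> 0"
  shows "Cauchy X"
proof (rule CauchyI')
  fix e :: real assume e: "e > 0"
  then have "\<forall>\<^sub>F m in sequentially. b m < \<kappa> * e\<^sup>2"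
    using \<open>\<kappa> > 0\<close> by (intro order_tendstoD[OF b]) simp
  then obtain N where N: "\<And>m. m \<ge> N \<Longrightarrow> b m < \<kappa> * e\<^sup>2"
    by (auto simp: eventually_sequentially)
  show "\<exists>N. \<forall>m\<ge>N. \<forall>n>m. dist (X m) (X n) < e"
  proof (intro exI allI impI)
    fix m n assume "N \<le> m" "m < n"
    then have "\<kappa> * (norm (X m - X n))\<^sup>2 < \<kappa> * e\<^sup>2"
      using le[of m n] N[of m] by simp
    then have "(norm (X m - X n))\<^sup>2 < e\<^sup>2" using \<open>\<kappa> > 0\<close> by simp
    then show "dist (X m) (X n) < e"
      using e by (simp add: dist_norm power_less_imp_less_base)
  qed
qed

context smooth_convex_space
begin

text \<open>The point minimises \<open>norm y ^ 2 - 2 * g y\<close> over \<open>D\<close>. The case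
  \<open>D = UNIV\<close> yields surjectivity of \<open>J\<close>, the case \<open>g = J x\<close>
  the generalized projection of \<open>x\<close>.\<close>

lemma quadratic_minimizer_exists:
  fixes g :: "'a \<Rightarrow>\<^sub>L real"
  assumes D: "D \<noteq> {}" "closed D" "convex D"
  shows "\<exists>m\<in>D. \<forall>y\<in>D. 0 \<le> blinfun_apply (duality_map m - g) (y - m)"
proof -
  define h where "h y = (norm y)\<^sup>2 - 2 * blinfun_apply g y" for y
  have "- (norm g)\<^sup>2 \<le> h y" for y
    using blinfun_le_norm[of g y] sum_squares_bound[of "norm g" "norm y"] by (simp add: h_def)
  then have bdd: "bdd_below (h ` D)" by (rule bdd_belowI2)
  define s where "s = Inf (h ` D)"
  have s_le: "s \<le> h y" if "y \<in> D" for y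
    using bdd that by (auto simp: s_def intro: cInf_lower)
  have h_mid: "h ((1/2) *\<^sub>R (x + y)) \<le> (h x + h y) / 2 - \<kappa> * (norm (x - y))\<^sup>2" for x y
    using midpoint[of x y] unfolding h_def blinfun.scaleR_right blinfun.add_right real_scaleR_def by argo
  have mid_D: "(1/2) *\<^sub>R (x + y) \<in> D" if "x \<in> D" "y \<in> D" for x y
    using convexD[OF D(3) that, of "1/2" "1/2"] by (simp add: scaleR_add_right)
  have "\<exists>y\<in>D. h y < s + inverse (real (Suc n))" for n
    using cInf_lessD[of "h ` D" "s + inverse (real (Suc n))"] D(1) by (auto simp: s_def)
  then obtain X where X: "\<And>n. X n \<in> D" "\<And>n. h (X n) < s + inverse (real (Suc n))"
    by metis
  have "Cauchy X"
  proof (rule Cauchy_if_square_bounded[OF \<kappa>_pos])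
    fix m n :: nat assume "m \<le> n"
    then have "inverse (real (Suc n)) \<le> inverse (real (Suc m))" by (intro le_imp_inverse_le) auto
    \<comment> \<open>The midpoint stays in \<open>D\<close>, so its value is at least
      \<open>s\<close>, while both endpoints are within \<open>1 / (m + 1)\<close> of
      \<open>s\<close>; the difference bounds the strong convexity term.\<close>
    then show "\<kappa> * (norm (X m - X n))\<^sup>2 \<le> inverse (real (Suc m))"
      using h_mid[of "X m" "X n"] X(2)[of m] X(2)[of n] s_le[OF mid_D[OF X(1)[of m] X(1)[of n]]]
      by argo
  qed (rule LIMSEQ_inverse_real_of_nat)
  then obtain m where m: "X \<longlonglongrightarrow> m" by (auto simp: Cauchy_convergent_iff convergent_def)
  have mD: "m \<in> D" using closed_sequentially[OF D(2)] X(1) m by blast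
  have "h m \<le> s"
  proof (rule LIMSEQ_le)
    show "(\<lambda>n. h (X n)) \<longlonglongrightarrow> h m" unfolding h_def by (intro tendsto_intros m)
    show "(\<lambda>n. s + inverse (real (Suc n))) \<longlonglongrightarrow> s"
      using tendsto_add[OF tendsto_const LIMSEQ_inverse_real_of_nat] by simp
  qed (use X(2) in \<open>auto intro!: exI[of _ 0] less_imp_le\<close>)
  then have min: "h m \<le> h y" if "y \<in> D" for y using s_le[OF that] by simp
  show ?thesis
  proof (intro bexI[OF _ mD] ballI)
    fix y assume y: "y \<in> D"
    \<comment> \<open>First order optimality is obtained from the subgradient at the displaced point
      \<open>?w t\<close>: comparing with \<open>h m \<le> h (?w t)\<close> and dividing by
      \<open>t\<close> leaves an inequality that passes to the limit by continuity of
      \<open>J\<close>.\<close>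
    let ?w = "\<lambda>t. m + t *\<^sub>R (y - m)"
    have "((\<lambda>t. ?w t) \<longlongrightarrow> m + 0 *\<^sub>R (y - m)) (at_right 0)" by (intro tendsto_intros)
    then have lim: "((\<lambda>t. blinfun_apply (duality_map (?w t) - g) (y - m))
        \<longlongrightarrow> blinfun_apply (duality_map m - g) (y - m)) (at_right 0)"
      by (intro tendsto_intros tendsto_duality_map blinfun.tendsto) simp
    have ev: "\<forall>\<^sub>F t in at_right 0. 0 \<le> blinfun_apply (duality_map (?w t) - g) (y - m)"
      using eventually_at_right_real[OF zero_less_one]
    proof eventually_elim
      case (elim t)
      have "?w t = (1 - t) *\<^sub>R m + t *\<^sub>R y" by (simp add: algebra_simps)
      then have "?w t \<in> D" using convexD[OF D(3) mD y, of "1 - t" t] elim by simp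
      then have "h m \<le> h (?w t)" by (rule min)
      moreover have "(norm (?w t))\<^sup>2 + 2 * blinfun_apply (duality_map (?w t)) (m - ?w t) \<le> (norm m)\<^sup>2"
        by (rule norm_square_subgradient)
      ultimately have "0 \<le> t * blinfun_apply (duality_map (?w t) - g) (y - m)"
        by (simp add: h_def blinfun.add_right blinfun.scaleR_right blinfun.diff_left blinfun.diff_right
            blinfun.minus_right algebra_simps)
      then show ?case using elim by (simp add: zero_le_mult_iff)
    qed
    show "0 \<le> blinfun_apply (duality_map m - g) (y - m)"
      by (rule tendsto_lowerbound[OF lim ev]) simp
  qed
qed

text \<open>Injectivity is strong monotonicity. For surjectivity, the variational inequality on the
  whole space holds in the directions \<open>y\<close> and \<open>- y\<close>, so it is an
  equality.\<close>

lemma bij_duality_map: "bij (duality_map :: 'a \<Rightarrow> _)"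
proof (rule bijI)
  show "inj (duality_map :: 'a \<Rightarrow> _)"
  proof (rule injI)
    fix x y :: 'a assume "duality_map x = duality_map y"
    then show "x = y"
      using norm_diff_le_duality_map[of x y] \<kappa>_pos by (simp add: mult_le_0_iff)
  qed
  show "surj (duality_map :: 'a \<Rightarrow> _)"
  unfolding surj_def
  proof
    fix g :: "'a \<Rightarrow>\<^sub>L real"
    obtain m where m: "\<And>y. 0 \<le> blinfun_apply (duality_map m - g) (y - m)"
      using quadratic_minimizer_exists[of UNIV g] by auto
    have "blinfun_apply (duality_map m - g) y = 0" for y
      using m[of "m + y"] m[of "m - y"] by (simp add: blinfun.minus_right)
    then have "duality_map m - g = 0" by (intro blinfun_eqI) simp
    then show "\<exists>x. g = duality_map x" by auto
  qed
qed

lemma duality_map_inv [simp]: "duality_map (inv_duality_map g :: 'a) = g"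
  unfolding inv_duality_map_def using bij_duality_map by (simp add: bij_is_surj surj_f_inv_f)

text \<open>\<open>arg_min_on\<close> chooses some minimiser. The extra term
  \<open>lyapunov y m\<close> in the hypothesis forces every minimiser to coincide with
  \<open>m\<close>. At the end this is applied to \<open>F\<close> itself.\<close>

lemma gen_proj_eqI:
  assumes "m \<in> D" "\<And>y. y \<in> D \<Longrightarrow> lyapunov y m + lyapunov m x \<le> lyapunov y (x::'a)"
  shows "gen_proj D x = m"
proof -
  let ?P = "is_arg_min (\<lambda>y. lyapunov y x) (\<lambda>y. y \<in> D)"
  have "?P m"
    unfolding is_arg_min_linorder
  proof (intro conjI allI impI assms(1))
    fix y assume "y \<in> D"
    from assms(2)[OF this] show "lyapunov m x \<le> lyapunov y x"
      using lyapunov_nonneg[of y m] by simp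
  qed
  then have P: "?P (gen_proj D x)"
    unfolding gen_proj_def arg_min_on_def arg_min_def by (rule someI)
  then have "lyapunov (gen_proj D x) m \<le> 0"
    using assms(1) assms(2)[of "gen_proj D x"] by (fastforce simp: is_arg_min_linorder)
  then have "2 * \<kappa> * (norm (gen_proj D x - m))\<^sup>2 \<le> 0"
    using lyapunov_ge order_trans by blast
  then show ?thesis using \<kappa>_pos by (simp add: mult_le_0_iff)
qed

lemma gen_proj_props:
  assumes D: "D \<noteq> {}" "closed D" "convex D"
  shows gen_proj_mem: "gen_proj D x \<in> D"
    and gen_proj_variational:
      "y \<in> D \<Longrightarrow> 0 \<le> blinfun_apply (duality_map (gen_proj D x) - duality_map x) (y - gen_proj D (x::'a))"
    and gen_proj_lyapunov:
      "y \<in> D \<Longrightarrow> lyapunov y (gen_proj D x) + lyapunov (gen_proj D x) x \<le> lyapunov y x"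
proof -
  obtain m where m: "m \<in> D" "\<And>y. y \<in> D \<Longrightarrow> 0 \<le> blinfun_apply (duality_map m - duality_map x) (y - m)"
    using quadratic_minimizer_exists[OF D, of "duality_map x"] by auto
  have le: "lyapunov y m + lyapunov m x \<le> lyapunov y x" if "y \<in> D" for y
    using lyapunov_three_point[of y x m] m(2)[OF that] by simp
  have "gen_proj D x = m" by (rule gen_proj_eqI[OF m(1) le])
  then show "gen_proj D x \<in> D"
    "y \<in> D \<Longrightarrow> 0 \<le> blinfun_apply (duality_map (gen_proj D x) - duality_map x) (y - gen_proj D x)"
    "y \<in> D \<Longrightarrow> lyapunov y (gen_proj D x) + lyapunov (gen_proj D x) x \<le> lyapunov y x"
    using m le by auto
qed

text \<open>\<open>GREATEST\<close> is meaningful only if the maximum is attained. The admissible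
  set is nonempty by strong monotonicity, bounded by 1, and contains its supremum because the
  condition is closed in \<open>c\<close>.\<close>

lemma convexity_c_props:
  defines "c \<equiv> convexity_c TYPE('a)"
  shows "0 < c" and "norm (x - y) \<le> 2 / c\<^sup>2 * norm (duality_map x - duality_map (y::'a))"
proof -
  define P where "P c \<longleftrightarrow> 0 < c \<and> c \<le> 1 \<and>
    (\<forall>x y::'a. norm (x - y) \<le> 2 / c\<^sup>2 * norm (duality_map x - duality_map y))" for c :: real
  have P_iff: "P c \<longleftrightarrow> 0 < c \<and> c \<le> 1 \<and>
      (\<forall>x y::'a. c\<^sup>2 * norm (x - y) \<le> 2 * norm (duality_map x - duality_map y))" for c
    by (auto simp: P_def field_simps)
  \<comment> \<open>Chosen so that \<open>c0\<^sup>2 \<le> 4 * \<kappa>\<close>, which is twice the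
    constant in \<open>norm_diff_le_duality_map\<close>.\<close>
  define c0 where "c0 = min 1 (2 * sqrt \<kappa>)"
  have c0: "c0 > 0" "c0 \<le> 1" using \<kappa>_pos by (auto simp: c0_def)
  have "c0\<^sup>2 \<le> (2 * sqrt \<kappa>)\<^sup>2" using c0 by (intro power_mono) (auto simp: c0_def)
  then have c0_sq: "c0\<^sup>2 \<le> 4 * \<kappa>" using \<kappa>_pos by (simp add: power_mult_distrib)
  have Pc0: "P c0"
    unfolding P_iff
  proof (intro conjI allI c0)
    fix x y :: 'a
    have "c0\<^sup>2 * norm (x - y) \<le> 4 * \<kappa> * norm (x - y)" by (intro mult_right_mono c0_sq) simp
    then show "c0\<^sup>2 * norm (x - y) \<le> 2 * norm (duality_map x - duality_map y)"
      using norm_diff_le_duality_map[of x y] by simp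
  qed
  define c1 where "c1 = Sup (Collect P)"
  have bdd: "bdd_above (Collect P)" by (rule bdd_aboveI[of _ 1]) (auto simp: P_def)
  have upper: "c \<le> c1" if "P c" for c
    using that bdd unfolding c1_def by (intro cSup_upper) auto
  have "P c1"
    unfolding P_iff
  proof (intro conjI allI)
    show pos: "0 < c1" using upper[OF Pc0] c0 by simp
    show "c1 \<le> 1" unfolding c1_def using Pc0 by (intro cSup_least) (auto simp: P_def)
    fix x y :: 'a
    show "c1\<^sup>2 * norm (x - y) \<le> 2 * norm (duality_map x - duality_map y)"
    proof (cases "x = y")
      case False
      \<comment> \<open>For fixed \<open>x \<noteq> y\<close> admissibility bounds \<open>c\<close>
        by this root, a bound that the supremum inherits.\<close>
      have "c1 \<le> sqrt (2 * norm (duality_map x - duality_map y) / norm (x - y))"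
        unfolding c1_def
      proof (rule cSup_least)
        fix c assume "c \<in> Collect P"
        then show "c \<le> sqrt (2 * norm (duality_map x - duality_map y) / norm (x - y))"
          using False by (intro real_le_rsqrt) (simp add: P_iff field_simps)
      qed (use Pc0 in auto)
      then have "c1\<^sup>2 \<le> (sqrt (2 * norm (duality_map x - duality_map y) / norm (x - y)))\<^sup>2"
        using pos by (intro power_mono) auto
      then show ?thesis using False by (simp add: field_simps)
    qed simp
  qed
  then have "c = c1"
    using upper unfolding c_def convexity_c_def P_def[symmetric] by (intro Greatest_equality) auto
  with \<open>P c1\<close> show "0 < c" "norm (x - y) \<le> 2 / c\<^sup>2 * norm (duality_map x - duality_map y)"
    by (auto simp: P_def)
qed

end

section \<open>Equilibrium problems and resolvents\<close>

context smooth_convex_space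
begin

text \<open>This stands in for weak compactness. The least-norm points \<open>p\<close> of finite
  intersections through \<open>B\<close> have bounded squared norms \<open>v\<close> that increase
  with the family. Along a chain whose values approach the supremum these points converge, and one
  more set moves them by a vanishing amount.\<close>

lemma closed_convex_Inter_nonempty:
  fixes \<F> :: "'a set set"
  assumes B: "B \<in> \<F>" "bounded B"
    and cc: "\<And>X. X \<in> \<F> \<Longrightarrow> closed X" "\<And>X. X \<in> \<F> \<Longrightarrow> convex X"
    and fip: "\<And>\<G>. finite \<G> \<Longrightarrow> \<G> \<subseteq> \<F> \<Longrightarrow> \<Inter>\<G> \<noteq> {}"
  shows "\<Inter>\<F> \<noteq> {}"
proof -
  define \<A> where "\<A> = {\<G>. finite \<G> \<and> \<G> \<subseteq> \<F> \<and> B \<in> \<G>}"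
  define p where "p \<G> = gen_proj (\<Inter>\<G>) (0::'a)" for \<G>
  define v where "v \<G> = (norm (p \<G>))\<^sup>2" for \<G>
  have "duality_map (0::'a) = 0" using norm_duality_map[of 0] by simp
  then have lyap0: "lyapunov y 0 = (norm y)\<^sup>2" for y :: 'a by (simp add: lyapunov_def)
  have \<A>: "\<Inter>\<G> \<noteq> {}" "closed (\<Inter>\<G>)" "convex (\<Inter>\<G>)" if "\<G> \<in> \<A>" for \<G>
  proof -
    have \<G>: "finite \<G>" "\<G> \<subseteq> \<F>" using that by (auto simp: \<A>_def)
    show "\<Inter>\<G> \<noteq> {}" using fip \<G> .
    show "closed (\<Inter>\<G>)" "convex (\<Inter>\<G>)"
      using cc \<G>(2) by (auto intro!: closed_Inter convex_Inter)
  qed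
  have p_mem: "p \<G> \<in> \<Inter>\<G>" if "\<G> \<in> \<A>" for \<G>
    unfolding p_def using gen_proj_mem[OF \<A>[OF that]] .
  have step: "2 * \<kappa> * (norm (p \<G> - p \<H>))\<^sup>2 \<le> v \<H> - v \<G>"
    if "\<G> \<in> \<A>" "\<H> \<in> \<A>" "\<G> \<subseteq> \<H>" for \<G> \<H>
  proof -
    have "p \<H> \<in> \<Inter>\<G>" using p_mem[OF that(2)] that(3) by blast
    from gen_proj_lyapunov[OF \<A>[OF that(1)] this, of 0] lyapunov_ge[of "p \<H>" "p \<G>"]
    show ?thesis by (simp add: v_def p_def lyap0 norm_minus_commute)
  qed
  have v_mono: "v \<G> \<le> v \<H>" if "\<G> \<in> \<A>" "\<H> \<in> \<A>" "\<G> \<subseteq> \<H>" for \<G> \<H>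
    using step[OF that] \<kappa>_pos by (smt (verit) mult_nonneg_nonneg zero_le_power2)
  obtain R where R: "\<And>y. y \<in> B \<Longrightarrow> norm y \<le> R" using B(2) by (auto simp: bounded_iff)
  have "v \<G> \<le> R\<^sup>2" if "\<G> \<in> \<A>" for \<G>
  proof -
    have "p \<G> \<in> B" using p_mem[OF that] that by (auto simp: \<A>_def)
    then show ?thesis unfolding v_def by (intro power_mono R) auto
  qed
  then have bdd: "bdd_above (v ` \<A>)" by (rule bdd_aboveI2)
  define s where "s = Sup (v ` \<A>)"
  have s_ge: "v \<G> \<le> s" if "\<G> \<in> \<A>" for \<G>
    using that bdd unfolding s_def by (intro cSup_upper) auto
  have "{B} \<in> \<A>" using B by (simp add: \<A>_def)
  then have "\<exists>\<G>\<in>\<A>. s - inverse (real (Suc n)) < v \<G>" for n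
    using less_cSupD[of "v ` \<A>" "s - inverse (real (Suc n))"] by (auto simp: s_def)
  then obtain G where G: "\<And>n. G n \<in> \<A>" "\<And>n. s - inverse (real (Suc n)) < v (G n)"
    by metis
  \<comment> \<open>Unions turn the near-optimal families into an increasing chain without lowering
    \<open>v\<close>.\<close>
  define H where "H n = (\<Union>i\<le>n. G i)" for n :: nat
  have H\<A>: "H n \<in> \<A>" for n using G(1) by (fastforce simp: H_def \<A>_def)
  have vH: "s - inverse (real (Suc n)) < v (H n)" for n
  proof -
    have "G n \<subseteq> H n" by (auto simp: H_def)
    from v_mono[OF G(1) H\<A> this] G(2)[of n] show ?thesis by linarith
  qed
  have near: "2 * \<kappa> * (norm (p (H n) - p \<G>))\<^sup>2 \<le> inverse (real (Suc n))"
    if "\<G> \<in> \<A>" "H n \<subseteq> \<G>" for \<G> n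
    using step[OF H\<A> that] s_ge[OF that(1)] vH[of n] by simp
  have "Cauchy (\<lambda>n. p (H n))"
  proof (rule Cauchy_if_square_bounded[OF _ _ LIMSEQ_inverse_real_of_nat])
    show "2 * \<kappa> > 0" using \<kappa>_pos by simp
    fix m n :: nat assume "m \<le> n"
    then have "H m \<subseteq> H n" unfolding H_def by (intro UN_mono) auto
    then show "2 * \<kappa> * (norm (p (H m) - p (H n)))\<^sup>2 \<le> inverse (real (Suc m))"
      by (rule near[OF H\<A>])
  qed
  then obtain q where q: "(\<lambda>n. p (H n)) \<longlonglongrightarrow> q" by (auto simp: Cauchy_convergent_iff convergent_def)
  have "q \<in> X" if X: "X \<in> \<F>" for X
  proof -
    \<comment> \<open>Adjoining \<open>X\<close> raises \<open>v\<close> by at most the remaining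
      gap to the supremum, so the least-norm points with and without \<open>X\<close> share the
      limit \<open>q\<close>, and those with \<open>X\<close> lie in the closed set
      \<open>X\<close>.\<close>
    have ins: "insert X (H n) \<in> \<A>" for n using H\<A>[of n] X by (auto simp: \<A>_def)
    define D where "D n = p (H n) - p (insert X (H n))" for n
    have "(\<lambda>n. inverse (real (Suc n)) / (2 * \<kappa>)) \<longlonglongrightarrow> 0"
      using tendsto_divide[OF LIMSEQ_inverse_real_of_nat tendsto_const[of "2 * \<kappa>"]] \<kappa>_pos by simp
    moreover have "norm ((norm (D n))\<^sup>2) \<le> inverse (real (Suc n)) / (2 * \<kappa>)" for n
      using near[OF ins subset_insertI, of n] \<kappa>_pos
      by (simp add: D_def pos_le_divide_eq mult.commute)
    ultimately have "(\<lambda>n. (norm (D n))\<^sup>2) \<longlonglongrightarrow> 0"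
      by (intro Lim_null_comparison[of "\<lambda>n. (norm (D n))\<^sup>2"]) auto
    from tendsto_real_sqrt[OF this] have "D \<longlonglongrightarrow> 0" by (simp add: tendsto_norm_zero_iff)
    from tendsto_diff[OF q this] have lim: "(\<lambda>n. p (insert X (H n))) \<longlonglongrightarrow> q"
      by (simp add: D_def)
    have "p (insert X (H n)) \<in> X" for n using p_mem[OF ins[of n]] by blast
    from closed_sequentially[OF cc(1)[OF X] this lim] show ?thesis .
  qed
  then show ?thesis by blast
qed

end

text \<open>The penalty \<open>P z = (\<Sum>v\<in>Y. (max 0 (G v z))\<^sup>2)\<close> takes the place of a fixed point or separation
  theorem: at a near minimiser \<open>z\<close> of \<open>P\<close> on the hull of \<open>Y\<close>, a small step towards the average
  of \<open>Y\<close> with weights \<open>max 0 (G v z)\<close> lowers \<open>P\<close> by about \<open>2 t P z\<close>.\<close>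

lemma monotone_bifunction_almost_solution:
  fixes G :: "'a::real_vector \<Rightarrow> 'a \<Rightarrow> real"
  assumes Y: "finite Y" "Y \<subseteq> C"
    and conv: "\<And>v. v \<in> Y \<Longrightarrow> convex_on C (G v)"
    and mono: "\<And>v w. v \<in> Y \<Longrightarrow> w \<in> Y \<Longrightarrow> G v w + G w v \<le> 0"
    and below: "\<And>v. v \<in> Y \<Longrightarrow> bdd_below (G v ` (convex hull Y))"
    and "Y \<noteq> {}" "e > 0"
  shows "\<exists>z\<in>C. \<forall>v\<in>Y. G v z \<le> e"
proof (rule ccontr)
  assume contra: "\<not> ?thesis"
  define K where "K = convex hull Y"
  have "convex C" using conv \<open>Y \<noteq> {}\<close> by (auto dest: convex_on_imp_convex)
  then have KC: "K \<subseteq> C" unfolding K_def using Y(2) by (intro hull_minimal) auto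
  have YK: "Y \<subseteq> K" by (simp add: K_def hull_subset)
  have convK: "convex K" by (simp add: K_def)
  \<comment> \<open>Upper bounds come from convexity and the finitely many vertices, lower bounds
    from \<open>below\<close>. They make \<open>B\<close>, the bound on the second order error,
    finite.\<close>
  have "\<exists>R. \<forall>z\<in>K. \<bar>G v z\<bar> \<le> R" if v: "v \<in> Y" for v
  proof -
    obtain m where m: "\<And>z. z \<in> K \<Longrightarrow> m \<le> G v z"
      using below[OF v] by (auto simp: bdd_below_def K_def)
    have "convex_on K (G v)" using conv[OF v] KC convK by (rule convex_on_subset)
    then have "\<forall>z\<in>K. G v z \<le> Max (G v ` Y)"
      unfolding K_def by (rule convex_on_convex_hull_bound) (use Y(1) in auto)
    then have "\<bar>G v z\<bar> \<le> \<bar>m\<bar> + \<bar>Max (G v ` Y)\<bar>" if "z \<in> K" for z using m[OF that] that by force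
    then show ?thesis by blast
  qed
  then obtain R0 where R0: "\<And>v z. v \<in> Y \<Longrightarrow> z \<in> K \<Longrightarrow> \<bar>G v z\<bar> \<le> R0 v" by metis
  define P where "P z = (\<Sum>v\<in>Y. (max 0 (G v z))\<^sup>2)" for z
  define B where "B = (\<Sum>v\<in>Y. (2 * R0 v)\<^sup>2)"
  define s where "s = Inf (P ` K)"
  have "B \<ge> 0" unfolding B_def by (intro sum_nonneg) simp
  have P_large: "e\<^sup>2 \<le> P z" if z: "z \<in> K" for z
  proof -
    obtain v where v: "v \<in> Y" "e < G v z" using contra z KC by force
    have "e\<^sup>2 \<le> (max 0 (G v z))\<^sup>2" using v \<open>e > 0\<close> by (intro power_mono) auto
    also have "\<dots> \<le> P z" unfolding P_def by (rule member_le_sum) (use v Y in auto)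
    finally show ?thesis .
  qed
  have K_ne: "K \<noteq> {}" using \<open>Y \<noteq> {}\<close> YK by auto
  have bdd: "bdd_below (P ` K)" using P_large by (rule bdd_belowI2)
  have s_ge: "e\<^sup>2 \<le> s" unfolding s_def using K_ne P_large by (intro cInf_greatest) auto
  \<comment> \<open>One step of length \<open>t\<close> from a \<open>t\<^sup>2\<close>-near
    minimiser will give \<open>2 * s < t * (1 + B)\<close>. This \<open>t\<close> bounds the right
    side by \<open>e\<^sup>2\<close>, contradicting \<open>e\<^sup>2 \<le> s\<close>.\<close>
  define t where "t = min 1 (e\<^sup>2 / (1 + B))"
  have t: "0 < t" "t \<le> 1" "t * (1 + B) \<le> e\<^sup>2"
  proof -
    have "t \<le> e\<^sup>2 / (1 + B)" by (simp add: t_def)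
    then show "t * (1 + B) \<le> e\<^sup>2" using \<open>B \<ge> 0\<close> by (simp add: pos_le_divide_eq)
  qed (use \<open>B \<ge> 0\<close> \<open>e > 0\<close> in \<open>auto simp: t_def\<close>)
  obtain z where z: "z \<in> K" "P z < s + t\<^sup>2"
    using cInf_lessD[of "P ` K" "s + t\<^sup>2"] K_ne t by (auto simp: s_def)
  define \<mu> where "\<mu> v = max 0 (G v z)" for v
  have \<mu>: "\<mu> v \<ge> 0" for v by (simp add: \<mu>_def)
  define S where "S = sum \<mu> Y"
  have "S > 0"
  proof -
    obtain v where v: "v \<in> Y" "e < G v z" using contra z KC by force
    have "0 < \<mu> v" using v \<open>e > 0\<close> by (simp add: \<mu>_def)
    also have "\<mu> v \<le> S" unfolding S_def using v Y \<mu> by (intro member_le_sum) auto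
    finally show ?thesis .
  qed
  define w where "w = (\<Sum>v\<in>Y. (\<mu> v / S) *\<^sub>R v)"
  have weights: "(\<Sum>v\<in>Y. \<mu> v / S) = 1" "\<And>v. \<mu> v / S \<ge> 0"
    using \<open>S > 0\<close> \<mu> by (auto simp: S_def simp flip: sum_divide_distrib)
  have wK: "w \<in> K"
    unfolding w_def using weights YK convK Y(1) by (intro convex_sum) auto
  have "G v w \<le> (\<Sum>v'\<in>Y. \<mu> v' / S * G v v')" if "v \<in> Y" for v
    unfolding w_def using weights Y \<open>Y \<noteq> {}\<close> by (intro convex_on_sum[OF _ _ conv[OF that]]) auto
  then have "(\<Sum>v\<in>Y. \<mu> v * G v w) \<le> (\<Sum>v\<in>Y. \<mu> v * (\<Sum>v'\<in>Y. \<mu> v' / S * G v v'))"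
    using \<mu> by (intro sum_mono mult_left_mono) auto
  also have "\<dots> = (\<Sum>v\<in>Y. \<Sum>v'\<in>Y. \<mu> v * \<mu> v' * G v v') / S"
    by (simp add: sum_distrib_left sum_divide_distrib mult.assoc)
  also have "\<dots> \<le> 0"
  proof -
    \<comment> \<open>Interchanging the summation indices pairs \<open>G v v'\<close> with
      \<open>G v' v\<close>, and monotonicity makes each pair nonpositive.\<close>
    let ?T = "\<Sum>v\<in>Y. \<Sum>v'\<in>Y. \<mu> v * \<mu> v' * G v v'"
    have "?T = (\<Sum>v\<in>Y. \<Sum>v'\<in>Y. \<mu> v * \<mu> v' * G v' v)"
      by (subst sum.swap) (simp add: mult.commute)
    then have "?T + ?T = (\<Sum>v\<in>Y. \<Sum>v'\<in>Y. \<mu> v * \<mu> v' * (G v v' + G v' v))"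
      by (simp add: sum.distrib distrib_left)
    also have "\<dots> \<le> 0"
      using \<mu> mono by (intro sum_nonpos mult_nonneg_nonpos) auto
    finally show ?thesis using \<open>S > 0\<close> by (simp add: divide_le_0_iff)
  qed
  finally have w_le: "(\<Sum>v\<in>Y. \<mu> v * G v w) \<le> 0" .
  have \<mu>G: "\<mu> v * G v z = (max 0 (G v z))\<^sup>2" for v
    by (simp add: \<mu>_def max_def power2_eq_square)
  define z' where "z' = (1 - t) *\<^sub>R z + t *\<^sub>R w"
  have z'K: "z' \<in> K" unfolding z'_def using t by (intro convexD[OF convK z(1) wK]) auto
  have sq: "(max 0 x)\<^sup>2 \<le> y\<^sup>2" if "x \<le> y" for x y :: real
  proof -
    have "(max 0 x)\<^sup>2 \<le> \<bar>y\<bar>\<^sup>2" using that by (intro power_mono) auto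
    then show ?thesis by simp
  qed
  have "P z' \<le> (\<Sum>v\<in>Y. (max 0 (G v z))\<^sup>2 + 2 * t * (\<mu> v * G v w - \<mu> v * G v z) + t\<^sup>2 * (2 * R0 v)\<^sup>2)"
    unfolding P_def
  proof (rule sum_mono)
    fix v assume v: "v \<in> Y"
    let ?a = "G v z" and ?b = "G v w - G v z"
    have "G v z' \<le> (1 - t) * G v z + t * G v w"
      unfolding z'_def using t z wK KC by (intro convex_onD[OF conv[OF v]]) auto
    then have le: "G v z' \<le> ?a + t * ?b" by (simp add: algebra_simps)
    \<comment> \<open>A first order expansion of the squared positive part; where
      \<open>G v z\<close> is negative the first order term vanishes and the error term alone
      suffices.\<close>
    have "(max 0 (G v z'))\<^sup>2 \<le> (max 0 ?a)\<^sup>2 + 2 * t * (max 0 ?a * ?b) + t\<^sup>2 * ?b\<^sup>2"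
    proof (cases "?a \<ge> 0")
      case True
      have "(max 0 (G v z'))\<^sup>2 \<le> (?a + t * ?b)\<^sup>2"
        by (rule sq[OF le])
      then show ?thesis using True by (simp add: power2_eq_square algebra_simps max_def)
    next
      case False
      then have "(max 0 (G v z'))\<^sup>2 \<le> (t * ?b)\<^sup>2"
        using le by (intro sq) simp
      then show ?thesis using False by (simp add: power_mult_distrib max_def)
    qed
    also have "t\<^sup>2 * ?b\<^sup>2 \<le> t\<^sup>2 * (2 * R0 v)\<^sup>2"
    proof (rule mult_left_mono)
      have "\<bar>?b\<bar> \<le> 2 * R0 v" using R0[OF v z(1)] R0[OF v wK] by argo
      then show "?b\<^sup>2 \<le> (2 * R0 v)\<^sup>2" 
        unfolding abs_le_square_iff[symmetric] by linarith
    qed simp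
    finally show "(max 0 (G v z'))\<^sup>2
        \<le> (max 0 (G v z))\<^sup>2 + 2 * t * (\<mu> v * G v w - \<mu> v * G v z) + t\<^sup>2 * (2 * R0 v)\<^sup>2"
      by (simp add: \<mu>_def right_diff_distrib)
  qed
  also have "\<dots> = P z + 2 * t * ((\<Sum>v\<in>Y. \<mu> v * G v w) - P z) + t\<^sup>2 * B"
    unfolding P_def B_def \<mu>G by (simp add: sum.distrib sum_subtractf sum_distrib_left right_diff_distrib)
  also have "\<dots> \<le> P z + 2 * t * (0 - P z) + t\<^sup>2 * B"
    using w_le t by (intro add_mono mult_left_mono) auto
  finally have "P z' \<le> P z - 2 * t * P z + t\<^sup>2 * B" by simp
  moreover have "s \<le> P z'" "s \<le> P z"
    unfolding s_def using bdd z'K z by (auto intro: cInf_lower)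
  moreover have "2 * t * s \<le> 2 * t * P z" using t \<open>s \<le> P z\<close> by simp
  ultimately have "2 * t * s < t * (t * (1 + B))"
    using z(2) by (simp add: power2_eq_square algebra_simps)
  then have "2 * s < t * (1 + B)" using t(1) by (simp add: mult.left_commute)
  then show False using t(3) s_ge \<open>e > 0\<close> by (smt (verit) zero_less_power)
qed

section \<open>Lower semicontinuity and the Minty argument\<close>

lemma lsc_eventually_at:
  assumes "lower_semicontinuous_on C g" "x \<in> C" "e > 0"
  shows "\<forall>\<^sub>F y in at x within C. g x - e < g y"
proof -
  have "ereal (g x) \<le> Liminf (at x within C) (\<lambda>y. ereal (g y))"
    using assms by (simp add: lower_semicontinuous_on_def)
  from this[unfolded le_Liminf_iff, rule_format, of "ereal (g x - e)"] show ?thesis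
    using assms(3) by simp
qed

text \<open>The definition looks only at punctured neighbourhoods, but \<open>X\<close> may take the
  value \<open>x\<close>; there the bound is trivial.\<close>

lemma lsc_eventually_greater:
  assumes g: "lower_semicontinuous_on C g" and x: "x \<in> C"
    and X: "(X \<longlongrightarrow> x) F" "\<And>n. X n \<in> C" and e: "e > 0"
  shows "\<forall>\<^sub>F n in F. g x - e < g (X n)"
proof -
  have "\<forall>\<^sub>F y in nhds x. y \<in> C \<longrightarrow> g x - e < g y"
    using lsc_eventually_at[OF g x e] e unfolding eventually_at_filter by (auto elim: eventually_mono)
  with X(1) have "\<forall>\<^sub>F n in F. X n \<in> C \<longrightarrow> g x - e < g (X n)"
    unfolding filterlim_iff by blast
  then show ?thesis using X(2) by simp
qed

lemma lsc_le_limit: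
  assumes "lower_semicontinuous_on C g" "x \<in> C" "X \<longlonglongrightarrow> x" "\<And>n. X n \<in> C"
    and le: "\<And>n. g (X n) \<le> b n" and b: "b \<longlonglongrightarrow> l"
  shows "g x \<le> l"
proof (rule field_le_epsilon)
  fix e :: real assume e: "e > 0"
  have "\<forall>\<^sub>F n in sequentially. g x - e \<le> b n"
    using lsc_eventually_greater[OF assms(1-4) e]
  proof eventually_elim
    case (elim n)
    then show ?case using le[of n] by linarith
  qed
  from tendsto_lowerbound[OF b this] show "g x \<le> l + e" by simp
qed

text \<open>Lower semicontinuity bounds \<open>g\<close> below on a ball of radius \<open>r\<close>
  around \<open>x\<close>. For \<open>y\<close> outside, the bound at the point of the segment at
  distance \<open>r\<close> extends to \<open>y\<close> by convexity, with slope
  \<open>1 / r\<close>.\<close>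

lemma convex_lsc_linear_lower_bound:
  fixes g :: "'a::real_normed_vector \<Rightarrow> real"
  assumes conv: "convex_on C g" and lsc: "lower_semicontinuous_on C g" and x: "x \<in> C"
  shows "\<exists>L\<ge>0. \<forall>y\<in>C. g x - 1 - L * norm (y - x) \<le> g y"
proof -
  obtain d where d: "d > 0" "\<And>y. y \<in> C \<Longrightarrow> y \<noteq> x \<Longrightarrow> dist y x < d \<Longrightarrow> g x - 1 < g y"
    using lsc_eventually_at[OF lsc x zero_less_one] by (auto simp: eventually_at)
  define r where "r = d / 2"
  have r: "r > 0" "r < d" using d by (auto simp: r_def)
  have "g x - 1 - inverse r * norm (y - x) \<le> g y" if y: "y \<in> C" for y
  proof (cases "norm (y - x) \<le> r")
    case True
    have "g x - 1 \<le> g y" using d(2)[OF y] True r by (cases "y = x") (auto simp: dist_norm)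
    moreover have "0 \<le> inverse r * norm (y - x)" using r by simp
    ultimately show ?thesis by linarith
  next
    case False
    define s where "s = r / norm (y - x)"
    have "norm (y - x) > 0" using False r by linarith
    then have s: "0 < s" "s < 1" "s * norm (y - x) = r"
      using False r by (simp_all add: s_def divide_less_eq)
    let ?w = "(1 - s) *\<^sub>R x + s *\<^sub>R y"
    have "?w \<in> C" using convexD[OF convex_on_imp_convex[OF conv] x y, of "1 - s" s] s by simp
    moreover have "?w - x = s *\<^sub>R (y - x)" by (simp add: algebra_simps)
    then have nw: "norm (?w - x) = r" using s by simp
    ultimately have "g x - 1 < g ?w" using r by (intro d(2)) (auto simp: dist_norm)
    also have "\<dots> \<le> (1 - s) * g x + s * g y" using s by (intro convex_onD[OF conv _ _ x y]) auto
    finally have "- 1 < s * (g y - g x)" by (simp add: algebra_simps)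
    then have "- inverse s < g y - g x" using s(1) by (simp add: field_simps)
    moreover have "inverse s = inverse r * norm (y - x)" by (simp add: s_def divide_inverse)
    ultimately show ?thesis by linarith
  qed
  then show ?thesis using r by (intro exI[of _ "inverse r"]) auto
qed

definition equilibrium_bifunction :: "'a::real_normed_vector set \<Rightarrow> ('a \<Rightarrow> 'a \<Rightarrow> real) \<Rightarrow> bool" where
  "equilibrium_bifunction C f \<longleftrightarrow>
     (\<forall>v\<in>C. f v v = 0) \<and>
     (\<forall>v\<in>C. \<forall>w\<in>C. f v w + f w v \<le> 0) \<and>
     (\<forall>v\<in>C. \<forall>w\<in>C. \<forall>q\<in>C.
        Limsup (at_right 0) (\<lambda>t::real. ereal (f (t *\<^sub>R q + (1 - t) *\<^sub>R v) w)) \<le> ereal (f v w)) \<and>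
     (\<forall>v\<in>C. convex_on C (f v) \<and> lower_semicontinuous_on C (f v))"

lemma equilibrium_bifunctionD:
  assumes "equilibrium_bifunction C f" "v \<in> C"
  shows "f v v = 0" "w \<in> C \<Longrightarrow> f v w + f w v \<le> 0" "convex_on C (f v)" "lower_semicontinuous_on C (f v)"
    "w \<in> C \<Longrightarrow> q \<in> C \<Longrightarrow>
      Limsup (at_right 0) (\<lambda>t::real. ereal (f (t *\<^sub>R q + (1 - t) *\<^sub>R v) w)) \<le> ereal (f v w)"
  using assms unfolding equilibrium_bifunction_def by blast+

text \<open>On the segment from \<open>z\<close> to \<open>y\<close>, \<open>0 = f w w\<close> is
  split by convexity; the hypothesis controls \<open>f w z\<close>, division by \<open>t\<close>
  leaves \<open>f w y\<close>, and (A3) passes to the limit. The term \<open>\<psi>\<close> is the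
  Lyapunov penalty for resolvents and 0 for the equilibrium problem itself.\<close>

lemma minty:
  fixes f :: "'a::real_normed_vector \<Rightarrow> 'a \<Rightarrow> real" and \<psi> :: "'a \<Rightarrow> real"
  assumes f: "equilibrium_bifunction C f" and \<psi>: "convex_on C \<psi>"
    and z: "z \<in> C" "\<And>y. y \<in> C \<Longrightarrow> f y z + \<psi> z - \<psi> y \<le> 0" and y: "y \<in> C"
  shows "0 \<le> f z y + \<psi> y - \<psi> z"
proof -
  let ?w = "\<lambda>t. t *\<^sub>R y + (1 - t) *\<^sub>R z"
  have ev: "\<forall>\<^sub>F t in at_right 0. ereal ((1 - t) * (\<psi> z - \<psi> y)) \<le> ereal (f (?w t) y)"
    using eventually_at_right_real[OF zero_less_one]
  proof eventually_elim
    case (elim t)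
    then have t: "0 \<le> t" "t \<le> 1" "0 < t" by auto
    have w_eq: "?w t = (1 - t) *\<^sub>R z + t *\<^sub>R y" by simp
    have w: "?w t \<in> C"
      using convexD[OF convex_on_imp_convex[OF \<psi>] z(1) y, of "1 - t" t] t by (simp add: add.commute)
    have "\<psi> (?w t) \<le> (1 - t) * \<psi> z + t * \<psi> y"
      unfolding w_eq using t(1,2) by (rule convex_onD[OF \<psi> _ _ z(1) y])
    then have "f (?w t) z \<le> t * (\<psi> y - \<psi> z)"
      using z(2)[OF w] by (simp add: algebra_simps)
    then have "(1 - t) * f (?w t) z \<le> (1 - t) * (t * (\<psi> y - \<psi> z))"
      using t by (intro mult_left_mono) auto
    moreover have "f (?w t) (?w t) \<le> (1 - t) * f (?w t) z + t * f (?w t) y"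
      using convex_onD[OF equilibrium_bifunctionD(3)[OF f w] t(1,2) z(1) y] unfolding w_eq .
    ultimately have "0 \<le> t * (f (?w t) y - (1 - t) * (\<psi> z - \<psi> y))"
      using equilibrium_bifunctionD(1)[OF f w] by (simp add: algebra_simps)
    then show ?case using t by (simp add: zero_le_mult_iff)
  qed
  have "((\<lambda>t::real. ereal ((1 - t) * (\<psi> z - \<psi> y))) \<longlongrightarrow> ereal ((1 - 0) * (\<psi> z - \<psi> y))) (at_right 0)"
    by (intro tendsto_intros)
  then have "Limsup (at_right 0) (\<lambda>t::real. ereal ((1 - t) * (\<psi> z - \<psi> y))) = ereal (\<psi> z - \<psi> y)"
    by (intro lim_imp_Limsup) auto
  then have "ereal (\<psi> z - \<psi> y) \<le> Limsup (at_right 0) (\<lambda>t. ereal (f (?w t) y))"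
    using Limsup_mono[OF ev] by simp
  also have "\<dots> \<le> ereal (f z y)" by (rule equilibrium_bifunctionD(5)[OF f z(1) y y])
  finally show ?thesis by simp
qed

section \<open>Existence, uniqueness and estimates for resolvents\<close>

context smooth_convex_space
begin

lemma lyapunov_diff_le:
  "lyapunov w x - lyapunov z x \<le> 2 * blinfun_apply (duality_map w - duality_map x) (w - z :: 'a)"
  using lyapunov_three_point[of z x w] lyapunov_nonneg[of z w]
  by (simp add: blinfun.diff_right)

text \<open>Averaging the two subgradient inequalities at the convex combination cancels their
  linear terms.\<close>

lemma convex_on_lyapunov:
  assumes "convex C"
  shows "convex_on C (\<lambda>w. lyapunov w (x::'a))"
proof (rule convex_onI[OF _ assms])
  fix t :: real and a b :: 'a assume t: "0 < t" "t < 1"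
  let ?w = "(1 - t) *\<^sub>R a + t *\<^sub>R b"
  define g where "g = duality_map ?w - duality_map x"
  define l where "l u = 2 * blinfun_apply g (?w - u)" for u
  have "?w - a = t *\<^sub>R (b - a)" "?w - b = (1 - t) *\<^sub>R (a - b)" by (simp_all add: algebra_simps)
  then have "l a = 2 * (t * blinfun_apply g (b - a))" "l b = 2 * ((1 - t) * blinfun_apply g (a - b))"
    by (simp_all only: l_def blinfun.scaleR_right real_scaleR_def)
  then have "(1 - t) * l a + t * l b = 0"
    by (simp only: blinfun.diff_right) (simp add: algebra_simps)
  moreover have "(1 - t) * (lyapunov ?w x - lyapunov a x) \<le> (1 - t) * l a"
    "t * (lyapunov ?w x - lyapunov b x) \<le> t * l b"
    using t unfolding l_def g_def by (intro mult_left_mono lyapunov_diff_le; simp)+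
  ultimately show "lyapunov ?w x \<le> (1 - t) * lyapunov a x + t * lyapunov b x"
    by (simp add: algebra_simps)
qed

text \<open>The dual problem \<open>G y z \<le> 0\<close> for all \<open>y\<close> is solved first:
  its relaxed level sets are closed and convex, one is bounded, and finitely many always meet.
  Minty's argument and differentiation of \<open>\<psi>\<close> then give the resolvent
  inequality.\<close>

lemma resolvent_point_exists:
  fixes C :: "'a set"
  assumes C: "C \<noteq> {}" "closed C" "convex C" and f: "equilibrium_bifunction C f" and r: "r > 0"
  shows "\<exists>z\<in>C. \<forall>y\<in>C. 0 \<le> f z y + (1 / r) * blinfun_apply (duality_map z - duality_map x) (y - z)"
proof -
  note f = equilibrium_bifunctionD[OF f]
  \<comment> \<open>The factor makes \<open>(J w - J x) / r\<close> the gradient of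
    \<open>\<psi>\<close> at \<open>w\<close>.\<close>
  define \<psi> where "\<psi> w = 1 / (2 * r) * lyapunov w x" for w
  have \<psi>_nonneg: "0 \<le> \<psi> w" for w using r lyapunov_nonneg[of w x] by (simp add: \<psi>_def)
  have \<psi>_conv: "convex_on C \<psi>"
    unfolding \<psi>_def using r by (intro convex_on_cmul convex_on_lyapunov C) simp
  have \<psi>_diff: "\<psi> w - \<psi> z \<le> 1 / r * blinfun_apply (duality_map w - duality_map x) (w - z)" for w z
    using mult_left_mono[OF lyapunov_diff_le[of w x z], of "1 / (2 * r)"] r
    by (simp add: \<psi>_def field_simps)
  define k where "k = \<kappa> / r"
  have k: "k > 0" using \<kappa>_pos r by (simp add: k_def)
  have \<psi>_growth: "k * (norm (w - x))\<^sup>2 \<le> \<psi> w" for w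
    using lyapunov_ge[of w x] r by (simp add: \<psi>_def k_def field_simps)
  define G where "G y z = f y z + \<psi> z - \<psi> y" for y z
  have G_conv: "convex_on C (G y)" if "y \<in> C" for y
    unfolding G_def diff_conv_add_uminus using f(3)[OF that] \<psi>_conv C(3)
    by (intro convex_on_add) (auto simp: convex_on_const)
  have G_lower: "\<exists>L\<ge>0. \<forall>z\<in>C. f y y - 1 - L * norm (z - y) + \<psi> z - \<psi> y \<le> G y z" if "y \<in> C" for y
    using convex_lsc_linear_lower_bound[OF f(3,4)[OF that] that]
    by (fastforce simp: G_def intro!: diff_right_mono add_right_mono)
  \<comment> \<open>Positive levels \<open>e\<close> are used because finite subfamilies have only
    approximate solutions.\<close>
  define Lev where "Lev = (\<lambda>(y, e). {z \<in> C. G y z \<le> e})"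
  define \<F> where "\<F> = Lev ` (C \<times> {0<..})"
  obtain y0 where y0: "y0 \<in> C" using C(1) by blast
  have "\<Inter>\<F> \<noteq> {}"
  proof (rule closed_convex_Inter_nonempty)
    show "Lev (y0, 1) \<in> \<F>" using y0 by (auto simp: \<F>_def)
    obtain L where L: "L \<ge> 0" "\<And>z. z \<in> C \<Longrightarrow> - 1 - L * norm (z - y0) + \<psi> z - \<psi> y0 \<le> G y0 z"
      using G_lower[OF y0] f(1)[OF y0] by auto
    \<comment> \<open>The quadratic growth of \<open>\<psi>\<close> beats the linear lower bound of
      \<open>f\<close>: on the level set \<open>n = norm (z - x)\<close> satisfies
      \<open>k * n\<^sup>2 \<le> b + L * n\<close>, so \<open>n \<le> (L + b) / k\<close> once
      \<open>n > 1\<close>. The 2 in \<open>b\<close> is the level 1 plus the slack 1.\<close>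
    define b where "b = 2 + \<psi> y0 + L * norm (x - y0)"
    define D where "D = 1 + (L + b) / k"
    have b: "b \<ge> 0" using L(1) \<psi>_nonneg by (simp add: b_def)
    have "norm (z - x) \<le> D" if "z \<in> Lev (y0, 1)" for z
    proof (cases "norm (z - x) \<le> 1")
      case True
      moreover have "0 \<le> (L + b) / k" using L(1) b k by (intro divide_nonneg_pos) auto
      ultimately show ?thesis unfolding D_def by linarith
    next
      case False
      let ?n = "norm (z - x)"
      have z: "z \<in> C" "G y0 z \<le> 1" using that by (auto simp: Lev_def)
      have "L * norm (z - y0) \<le> L * (?n + norm (x - y0))"
        using norm_triangle_ineq[of "z - x" "x - y0"] L(1) by (intro mult_left_mono) auto
      then have "k * ?n\<^sup>2 \<le> b + L * ?n"
        using L(2)[OF z(1)] z(2) \<psi>_growth[of z] unfolding b_def distrib_left by linarith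
      also have "\<dots> \<le> b * ?n + L * ?n" using mult_left_mono[of 1 ?n b] b False by simp
      finally have "k * ?n * ?n \<le> (L + b) * ?n" by (simp add: power2_eq_square algebra_simps)
      moreover have "0 < ?n" using False by linarith
      ultimately have "k * ?n \<le> L + b" by (rule mult_right_le_imp_le)
      then have "?n \<le> (L + b) / k" using k by (simp add: pos_le_divide_eq mult.commute)
      then show ?thesis by (simp add: D_def)
    qed
    then have "Lev (y0, 1) \<subseteq> cball x D" by (auto simp: dist_norm norm_minus_commute)
    then show "bounded (Lev (y0, 1))" using bounded_cball bounded_subset by blast
  next
    fix X assume "X \<in> \<F>"
    then obtain y e where y: "y \<in> C" and X: "X = {z \<in> C. G y z \<le> e}"
      by (auto simp: \<F>_def Lev_def)
    show "closed X"
      unfolding closed_sequential_limits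
    proof (intro allI impI, elim conjE)
      fix Z z assume Z: "\<forall>n. Z n \<in> X" "Z \<longlonglongrightarrow> z"
      then have ZC: "\<And>n. Z n \<in> C" and le: "\<And>n. f y (Z n) \<le> e + \<psi> y - \<psi> (Z n)"
        by (auto simp: X G_def algebra_simps)
      have z: "z \<in> C" using closed_sequentially[OF C(2)] ZC Z(2) by blast
      have "(\<lambda>n. e + \<psi> y - \<psi> (Z n)) \<longlonglongrightarrow> e + \<psi> y - \<psi> z"
        unfolding \<psi>_def by (intro tendsto_intros tendsto_lyapunov Z(2))
      from lsc_le_limit[OF f(4)[OF y] z Z(2) ZC le this] show "z \<in> X"
        using z by (simp add: X G_def)
    qed
    show "convex X"
    proof (rule convexI)
      fix v w and s t :: real
      assume vw: "v \<in> X" "w \<in> X" and st: "0 \<le> s" "0 \<le> t" "s + t = 1"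
      have "s = 1 - t" using st by simp
      have "G y (s *\<^sub>R v + t *\<^sub>R w) \<le> s * G y v + t * G y w"
        using convex_onD[OF G_conv[OF y] st(2), of v w] vw st
        by (simp add: X \<open>s = 1 - t\<close>)
      also have "\<dots> \<le> e" by (rule convex_bound_le) (use vw st in \<open>simp_all add: X\<close>)
      finally have "G y (s *\<^sub>R v + t *\<^sub>R w) \<le> e" .
      moreover have "s *\<^sub>R v + t *\<^sub>R w \<in> C" using vw st by (intro convexD[OF C(3)]) (auto simp: X)
      ultimately show "s *\<^sub>R v + t *\<^sub>R w \<in> X" by (simp add: X)
    qed
  next
    fix \<G> assume "finite \<G>" "\<G> \<subseteq> \<F>"
    then obtain I where I: "I \<subseteq> C \<times> {0<..}" "finite I" "\<G> = Lev ` I"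
      unfolding \<F>_def by (meson finite_subset_image)
    show "\<Inter>\<G> \<noteq> {}"
    proof (cases "I = {}")
      case False
      \<comment> \<open>One approximate solution at the smallest of the finitely many levels lies in
        all the sets.\<close>
      define Y e where "Y = fst ` I" and "e = Min (snd ` I)"
      have Y: "finite Y" "Y \<subseteq> C" "Y \<noteq> {}" using I False by (auto simp: Y_def)
      have e: "e > 0" "\<And>p. p \<in> I \<Longrightarrow> e \<le> snd p"
        using I False by (auto simp: e_def Min_gr_iff)
      have "\<exists>z\<in>C. \<forall>v\<in>Y. G v z \<le> e"
      proof (rule monotone_bifunction_almost_solution[OF Y(1,2)])
        fix v assume v: "v \<in> Y"
        then have vC: "v \<in> C" using Y by blast
        show "convex_on C (G v)" by (rule G_conv[OF vC])
        show "G v w + G w v \<le> 0" if "w \<in> Y" for w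
          using f(2)[OF vC, of w] that Y by (auto simp: G_def)
        obtain L where L: "L \<ge> 0" "\<And>z. z \<in> C \<Longrightarrow> f v v - 1 - L * norm (z - v) + \<psi> z - \<psi> v \<le> G v z"
          using G_lower[OF vC] by auto
        have "bounded (convex hull Y)" using Y(1) by (intro bounded_convex_hull finite_imp_bounded)
        then obtain R where R: "\<And>z. z \<in> convex hull Y \<Longrightarrow> dist v z \<le> R"
          by (auto simp: bounded_any_center[of _ v])
        have hull: "convex hull Y \<subseteq> C" using Y C by (intro hull_minimal)
        show "bdd_below (G v ` (convex hull Y))"
        proof (rule bdd_belowI2)
          fix z assume z: "z \<in> convex hull Y"
          have "L * norm (z - v) \<le> L * R"
            using R[OF z] L(1) by (intro mult_left_mono) (auto simp: dist_norm norm_minus_commute)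
          then show "f v v - 1 - L * R - \<psi> v \<le> G v z"
            using L(2)[of z] z hull \<psi>_nonneg[of z] by fastforce
        qed
      qed (use Y e in auto)
      then obtain z where z: "z \<in> C" "\<And>v. v \<in> Y \<Longrightarrow> G v z \<le> e" by blast
      have "z \<in> Lev p" if "p \<in> I" for p
        using z(1) z(2)[of "fst p"] e(2)[OF that] that by (auto simp: Lev_def Y_def split: prod.splits)
      then show ?thesis using I(3) by blast
    qed (use I(3) in simp)
  qed
  then obtain z where "z \<in> \<Inter>\<F>" by blast
  then have "z \<in> Lev (y, e)" if "y \<in> C" "e > 0" for y e
    using that by (simp add: \<F>_def)
  then have z: "z \<in> C \<and> G y z \<le> e" if "y \<in> C" "e > 0" for y e
    using that by (simp add: Lev_def)
  have zC: "z \<in> C" using z[OF y0 zero_less_one] by simp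
  have "G y z \<le> 0" if "y \<in> C" for y
    by (rule field_le_epsilon) (use z[OF that] in simp)
  then have sol: "0 \<le> f z y + \<psi> y - \<psi> z" if "y \<in> C" for y
    using minty[OF assms(4) \<psi>_conv zC _ that] by (simp add: G_def)
  show ?thesis
  proof (intro bexI[OF _ zC] ballI)
    fix y assume y: "y \<in> C"
    \<comment> \<open>The inequality for differences of \<open>\<psi>\<close> is tested at points
      moving to \<open>z\<close>; dividing by \<open>t\<close> and continuity of \<open>J\<close>
      replace the difference by the gradient pairing.\<close>
    let ?w = "\<lambda>t. z + t *\<^sub>R (y - z)"
    have "((\<lambda>t. ?w t) \<longlongrightarrow> z + 0 *\<^sub>R (y - z)) (at_right 0)" by (intro tendsto_intros)
    then have lim: "((\<lambda>t. f z y + 1 / r * blinfun_apply (duality_map (?w t) - duality_map x) (y - z))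
        \<longlongrightarrow> f z y + 1 / r * blinfun_apply (duality_map z - duality_map x) (y - z)) (at_right 0)"
      by (intro tendsto_intros tendsto_duality_map blinfun.tendsto) simp
    have ev: "\<forall>\<^sub>F t in at_right 0.
        0 \<le> f z y + 1 / r * blinfun_apply (duality_map (?w t) - duality_map x) (y - z)"
      using eventually_at_right_real[OF zero_less_one]
    proof eventually_elim
      case (elim t)
      then have t: "0 \<le> t" "t \<le> 1" "0 < t" by auto
      have w_eq: "?w t = (1 - t) *\<^sub>R z + t *\<^sub>R y" by (simp add: algebra_simps)
      have w: "?w t \<in> C" unfolding w_eq using convexD[OF C(3) zC y, of "1 - t" t] t by simp
      have "f z (?w t) \<le> (1 - t) * f z z + t * f z y"
        unfolding w_eq by (rule convex_onD[OF f(3)[OF zC] t(1,2) zC y])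
      moreover have "\<psi> (?w t) - \<psi> z
          \<le> t * (1 / r * blinfun_apply (duality_map (?w t) - duality_map x) (y - z))"
        using \<psi>_diff[of "?w t" z] by (simp add: blinfun.scaleR_right mult.left_commute)
      ultimately have "0 \<le> t * (f z y + 1 / r * blinfun_apply (duality_map (?w t) - duality_map x) (y - z))"
        using sol[OF w] f(1)[OF zC] by (simp add: distrib_left)
      then show ?case using t by (simp add: zero_le_mult_iff)
    qed
    show "0 \<le> f z y + 1 / r * blinfun_apply (duality_map z - duality_map x) (y - z)"
      by (rule tendsto_lowerbound[OF lim ev]) simp
  qed
qed

text \<open>Adding the inequalities of two candidates cancels \<open>f\<close> by (A2), and strong
  monotonicity of \<open>J\<close> makes them equal; so the \<open>THE\<close> in
  \<open>resolvent\<close> is well defined.\<close>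

lemma resolvent_props:
  fixes C :: "'a set"
  assumes C: "C \<noteq> {}" "closed C" "convex C" and f: "equilibrium_bifunction C f" and r: "r > 0"
  shows resolvent_mem: "resolvent C f r x \<in> C"
    and resolvent_equilibrium: "y \<in> C \<Longrightarrow> 0 \<le> f (resolvent C f r x) y + (1 / r) *
        blinfun_apply (duality_map (resolvent C f r x) - duality_map x) (y - resolvent C f r x)"
proof -
  let ?Q = "\<lambda>z. z \<in> C \<and>
    (\<forall>y\<in>C. f z y + (1 / r) * blinfun_apply (duality_map z - duality_map x) (y - z) \<ge> 0)"
  have "\<exists>!z. ?Q z"
  proof (rule ex_ex1I)
    show "\<exists>z. ?Q z" using resolvent_point_exists[OF assms] by blast
    fix z z' assume z: "?Q z" and z': "?Q z'"
    have "0 \<le> f z z' + (1 / r) * blinfun_apply (duality_map z - duality_map x) (z' - z)"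
      "0 \<le> f z' z + (1 / r) * blinfun_apply (duality_map z' - duality_map x) (z - z')"
      using z z' by auto
    moreover have "f z z' + f z' z \<le> 0" using equilibrium_bifunctionD(2)[OF f] z z' by blast
    ultimately have "0 \<le> (1 / r) * (blinfun_apply (duality_map z - duality_map x) (z' - z)
        + blinfun_apply (duality_map z' - duality_map x) (z - z'))"
      unfolding distrib_left by linarith
    then have "0 \<le> blinfun_apply (duality_map z - duality_map x) (z' - z)
        + blinfun_apply (duality_map z' - duality_map x) (z - z')"
      using r by (simp add: zero_le_divide_iff)
    then have "blinfun_apply (duality_map z - duality_map z') (z - z') \<le> 0"
      by (simp add: blinfun.diff_left blinfun.diff_right)
    with duality_map_strongly_monotone have "2 * \<kappa> * (norm (z - z'))\<^sup>2 \<le> 0" by (rule order_trans)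
    then show "z = z'" using \<kappa>_pos by (simp add: mult_le_0_iff)
  qed
  from theI'[OF this] show "resolvent C f r x \<in> C"
    "y \<in> C \<Longrightarrow> 0 \<le> f (resolvent C f r x) y + (1 / r) *
        blinfun_apply (duality_map (resolvent C f r x) - duality_map x) (y - resolvent C f r x)"
    unfolding resolvent_def by auto
qed

lemma resolvent_lyapunov:
  fixes C :: "'a set"
  assumes C: "C \<noteq> {}" "closed C" "convex C" and f: "equilibrium_bifunction C f" and r: "r > 0"
    and p: "p \<in> EP f C"
  shows "lyapunov p (resolvent C f r x) \<le> lyapunov p x"
proof -
  let ?u = "resolvent C f r x"
  have u: "?u \<in> C" and pC: "p \<in> C" using resolvent_mem[OF C f r] p by (auto simp: EP_def)
  have "f ?u p \<le> 0" using equilibrium_bifunctionD(2)[OF f pC u] p u by (auto simp: EP_def)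
  then have "0 \<le> (1 / r) * blinfun_apply (duality_map ?u - duality_map x) (p - ?u)"
    using resolvent_equilibrium[OF C f r pC, of x] by linarith
  then have "0 \<le> blinfun_apply (duality_map ?u - duality_map x) (p - ?u)"
    using r by (simp add: zero_le_divide_iff)
  then show ?thesis using lyapunov_three_point[of p x ?u] lyapunov_nonneg[of ?u x] by simp
qed

end

section \<open>Convergence of the hybrid method\<close>

context smooth_convex_space
begin

text \<open>The squared norm of \<open>v\<close> cancels, leaving an affine condition; this keeps
  every \<open>Cn n\<close> closed and convex.\<close>

lemma lyapunov_le_halfspace:
  fixes a b :: 'a
  shows "closed {v. lyapunov v a \<le> lyapunov v b}" and "convex {v. lyapunov v a \<le> lyapunov v b}"
proof -
  have eq: "{v. lyapunov v a \<le> lyapunov v b} =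
      {v. blinfun_apply (2 *\<^sub>R (duality_map b - duality_map a)) v \<le> (norm b)\<^sup>2 - (norm a)\<^sup>2}"
    by (auto simp: lyapunov_def blinfun.diff_left blinfun.scaleR_left)
  show "closed {v. lyapunov v a \<le> lyapunov v b}"
    unfolding eq by (intro closed_Collect_le continuous_intros)
  show "convex {v. lyapunov v a \<le> lyapunov v b}"
    unfolding eq
  proof (rule convexI)
    fix v w :: 'a and s t :: real
    assume "v \<in> {v. blinfun_apply (2 *\<^sub>R (duality_map b - duality_map a)) v \<le> (norm b)\<^sup>2 - (norm a)\<^sup>2}"
      "w \<in> {v. blinfun_apply (2 *\<^sub>R (duality_map b - duality_map a)) v \<le> (norm b)\<^sup>2 - (norm a)\<^sup>2}"
      and "0 \<le> s" "0 \<le> t" "s + t = 1"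
    then show "s *\<^sub>R v + t *\<^sub>R w
        \<in> {v. blinfun_apply (2 *\<^sub>R (duality_map b - duality_map a)) v \<le> (norm b)\<^sup>2 - (norm a)\<^sup>2}"
      unfolding mem_Collect_eq blinfun.add_right blinfun.scaleR_right real_scaleR_def
      by (intro convex_bound_le)
  qed
qed

lemma diff_tendsto_0_if_lyapunov:
  assumes "((\<lambda>n. lyapunov (X n) (Y n :: 'a)) \<longlongrightarrow> 0) F"
  shows "((\<lambda>n. X n - Y n) \<longlongrightarrow> 0) F"
proof -
  have "((\<lambda>n. lyapunov (X n) (Y n) / (2 * \<kappa>)) \<longlongrightarrow> 0) F"
    using tendsto_divide[OF assms tendsto_const[of "2 * \<kappa>"]] \<kappa>_pos by simp
  moreover have "norm ((norm (X n - Y n))\<^sup>2) \<le> lyapunov (X n) (Y n) / (2 * \<kappa>)" for n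
    using lyapunov_ge[of "X n" "Y n"] \<kappa>_pos by (simp add: pos_le_divide_eq mult.commute)
  ultimately have "((\<lambda>n. (norm (X n - Y n))\<^sup>2) \<longlongrightarrow> 0) F"
    by (intro Lim_null_comparison[of "\<lambda>n. (norm (X n - Y n))\<^sup>2"]) auto
  from tendsto_real_sqrt[OF this] show ?thesis by (simp add: tendsto_norm_zero_iff)
qed

text \<open>For fixed \<open>p\<close> and \<open>z\<close> the difference
  \<open>lyapunov p w - lyapunov z w\<close> is affine in \<open>J w\<close>, so averaging is exact.
  The retained terms \<open>lyapunov z (w j)\<close> later drive the convergence.\<close>

lemma lyapunov_mixture:
  fixes p z :: 'a
  assumes "(\<Sum>j\<in>I. \<beta> j) = 1" and z: "duality_map z = (\<Sum>j\<in>I. \<beta> j *\<^sub>R duality_map (w j))"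
  shows "lyapunov p z = (\<Sum>j\<in>I. \<beta> j * (lyapunov p (w j) - lyapunov z (w j)))"
proof -
  have "(\<Sum>j\<in>I. \<beta> j * (lyapunov p (w j) - lyapunov z (w j)))
      = (\<Sum>j\<in>I. \<beta> j * ((norm p)\<^sup>2 - (norm z)\<^sup>2) - 2 * (\<beta> j * blinfun_apply (duality_map (w j)) (p - z)))"
    by (intro sum.cong) (auto simp: lyapunov_def blinfun.diff_right algebra_simps)
  also have "\<dots> = ((norm p)\<^sup>2 - (norm z)\<^sup>2) - 2 * (\<Sum>j\<in>I. \<beta> j * blinfun_apply (duality_map (w j)) (p - z))"
    using assms(1) by (simp add: sum_subtractf flip: sum_distrib_left sum_distrib_right)
  also have "(\<Sum>j\<in>I. \<beta> j * blinfun_apply (duality_map (w j)) (p - z)) = blinfun_apply (duality_map z) (p - z)"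
    unfolding z by (simp add: blinfun.sum_left blinfun.scaleR_left)
  also have "(norm p)\<^sup>2 - (norm z)\<^sup>2 - 2 * blinfun_apply (duality_map z) (p - z) = lyapunov p z"
    by (simp add: lyapunov_def blinfun.diff_right duality_map_self)
  finally show ?thesis by simp
qed

lemma gradient_step_diff:
  "norm (inv_duality_map (duality_map v - l *\<^sub>R g) - v) \<le> 2 / (convexity_c TYPE('a))\<^sup>2 * (\<bar>l\<bar> * norm g)"
  for v :: 'a
  using convexity_c_props(2)[of "inv_duality_map (duality_map v - l *\<^sub>R g)" v] by simp

text \<open>The pairing with \<open>A v\<close> splits into a gain from inverse strong monotonicity,
  a term of good sign from \<open>VI\<close>, and the cost of the displacement \<open>w - v\<close>.
  By \<open>gradient_step_diff\<close> and (V3) that cost is also a multiple of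
  \<open>norm (A v - A p)\<close> squared.\<close>

lemma projected_gradient_step:
  fixes C :: "'a set"
  assumes C: "C \<noteq> {}" "closed C" "convex C"
    and ism: "inverse_strongly_monotone_on C \<alpha> A" and p: "p \<in> VI A C" and v: "v \<in> C"
    and V3: "norm (A v) \<le> norm (A v - A p)" and l: "l \<ge> 0"
  shows "lyapunov p (gen_proj C (inv_duality_map (duality_map v - l *\<^sub>R A v)))
    \<le> lyapunov p v - 2 * l * (\<alpha> - 2 * l / (convexity_c TYPE('a))\<^sup>2) * (norm (A v - A p))\<^sup>2"
proof -
  define w where "w = inv_duality_map (duality_map v - l *\<^sub>R A v)"
  define c2 where "c2 = (convexity_c TYPE('a))\<^sup>2"
  have c2: "c2 > 0" using convexity_c_props(1) by (simp add: c2_def)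
  have pC: "p \<in> C" using p by (simp add: VI_def)
  have Jw: "duality_map w - duality_map v = - l *\<^sub>R A v" by (simp add: w_def)
  have "lyapunov p (gen_proj C w) \<le> lyapunov p w"
    using gen_proj_lyapunov[OF C pC, of w] lyapunov_nonneg[of "gen_proj C w" w] by simp
  also have "lyapunov p w \<le> lyapunov p v + 2 * l * blinfun_apply (A v) (p - w)"
    using lyapunov_three_point[of p v w] lyapunov_nonneg[of w v] unfolding Jw
    by (simp add: blinfun.minus_left blinfun.scaleR_left)
  also have "blinfun_apply (A v) (p - w) =
      - blinfun_apply (A v - A p) (v - p) - blinfun_apply (A p) (v - p) - blinfun_apply (A v) (w - v)"
    by (simp add: blinfun.diff_left blinfun.diff_right)
  also have "\<dots> \<le> - (\<alpha> * (norm (A v - A p))\<^sup>2) - 0 + 2 * l / c2 * (norm (A v - A p))\<^sup>2"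
  proof -
    have "\<alpha> * (norm (A v - A p))\<^sup>2 \<le> blinfun_apply (A v - A p) (v - p)"
      using ism v pC by (simp add: inverse_strongly_monotone_on_def)
    moreover have "0 \<le> blinfun_apply (A p) (v - p)" using p v by (simp add: VI_def)
    moreover have "- blinfun_apply (A v) (w - v) \<le> 2 * l / c2 * (norm (A v - A p))\<^sup>2"
    proof -
      have "- blinfun_apply (A v) (w - v) \<le> norm (A v) * norm (w - v)"
        using norm_blinfun[of "A v" "w - v"] by simp
      also have "\<dots> \<le> norm (A v) * (2 / c2 * (l * norm (A v)))"
        using gradient_step_diff[of v l "A v"] l by (intro mult_left_mono) (auto simp: w_def c2_def)
      also have "\<dots> = 2 * l / c2 * (norm (A v))\<^sup>2" by (simp add: power2_eq_square)
      also have "\<dots> \<le> 2 * l / c2 * (norm (A v - A p))\<^sup>2"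
        using V3 l c2 by (intro mult_left_mono power_mono) auto
      finally show ?thesis .
    qed
    ultimately show ?thesis by linarith
  qed
  finally have "lyapunov p (gen_proj C w)
      \<le> lyapunov p v + 2 * l * (- (\<alpha> * (norm (A v - A p))\<^sup>2) - 0 + 2 * l / c2 * (norm (A v - A p))\<^sup>2)"
    using l by (simp add: mult_left_mono)
  also have "\<dots> = lyapunov p v - 2 * l * (\<alpha> - 2 * l / c2) * (norm (A v - A p))\<^sup>2"
    by (simp add: algebra_simps)
  finally show ?thesis by (simp add: w_def c2_def)
qed

end

lemma inverse_strongly_monotone_tendsto:
  assumes A: "inverse_strongly_monotone_on C \<alpha> A" and "\<alpha> > 0"
    and X: "(X \<longlongrightarrow> x) F" "\<And>n. X n \<in> C" and x: "x \<in> C"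
  shows "((\<lambda>n. A (X n)) \<longlongrightarrow> A x) F"
proof -
  have lip: "norm (A v - A w) \<le> norm (v - w) / \<alpha>" if "v \<in> C" "w \<in> C" for v w
  proof (cases "A v = A w")
    case False
    have "\<alpha> * (norm (A v - A w))\<^sup>2 \<le> blinfun_apply (A v - A w) (v - w)"
      using A that by (simp add: inverse_strongly_monotone_on_def)
    also have "\<dots> \<le> norm (v - w) * norm (A v - A w)"
      using blinfun_le_norm[of "A v - A w" "v - w"] by (simp add: mult.commute)
    finally have "(\<alpha> * norm (A v - A w)) * norm (A v - A w) \<le> norm (v - w) * norm (A v - A w)"
      by (simp add: power2_eq_square mult.assoc)
    then have "\<alpha> * norm (A v - A w) \<le> norm (v - w)" using False by (simp add: mult_le_cancel_right)
    then show ?thesis using \<open>\<alpha> > 0\<close> by (simp add: pos_le_divide_eq mult.commute)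
  qed (use \<open>\<alpha> > 0\<close> in simp)
  have "((\<lambda>n. norm (X n - x) / \<alpha>) \<longlongrightarrow> norm (x - x) / \<alpha>) F"
    using \<open>\<alpha> > 0\<close> by (intro tendsto_intros X) simp
  then have "((\<lambda>n. A (X n) - A x) \<longlongrightarrow> 0) F"
    using lip[OF X(2) x] by (intro Lim_null_comparison[of "\<lambda>n. A (X n) - A x"]) auto
  then show ?thesis by (simp add: LIM_zero_iff)
qed

theorem theorem3p4:
  fixes C :: "'a::banach set"
    and A :: "nat \<Rightarrow> 'a \<Rightarrow> ('a \<Rightarrow>\<^sub>L real)"
    and f :: "nat \<Rightarrow> 'a \<Rightarrow> 'a \<Rightarrow> real"
    and S :: "nat \<Rightarrow> 'a \<Rightarrow> 'a"
    and M N K :: nat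
    and \<alpha> a b d :: real
    and \<beta> :: "nat \<Rightarrow> nat \<Rightarrow> real"
    and lam r :: "nat \<Rightarrow> real"
    and F :: "'a set"
    and x0 :: 'a
    and Cn :: "nat \<Rightarrow> 'a set"
    and x ybar z ubar :: "nat \<Rightarrow> 'a"
    and y u :: "nat \<Rightarrow> nat \<Rightarrow> 'a"
    and i_sel k_sel :: "nat \<Rightarrow> nat"
  assumes space: "uniformly_smooth TYPE('a)" "two_uniformly_convex TYPE('a)"
    and C: "C \<noteq> {}" "closed C" "convex C"
    and MNK: "M \<ge> 1" "N \<ge> 1" "K \<ge> 1"
    and alpha: "\<alpha> > 0"
    and V1: "\<And>i. i \<in> {1..M} \<Longrightarrow> inverse_strongly_monotone_on C \<alpha> (A i)"
    and V2: "\<And>i. i \<in> {1..M} \<Longrightarrow> VI (A i) C \<noteq> {}"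
    and V3: "\<And>i v w. i \<in> {1..M} \<Longrightarrow> v \<in> C \<Longrightarrow> w \<in> VI (A i) C
               \<Longrightarrow> norm (A i v) \<le> norm (A i v - A i w)"
    and A1: "\<And>k v. k \<in> {1..K} \<Longrightarrow> v \<in> C \<Longrightarrow> f k v v = 0"
    and A2: "\<And>k v w. k \<in> {1..K} \<Longrightarrow> v \<in> C \<Longrightarrow> w \<in> C \<Longrightarrow> f k v w + f k w v \<le> 0"
    and A3: "\<And>k v w q. k \<in> {1..K} \<Longrightarrow> v \<in> C \<Longrightarrow> w \<in> C \<Longrightarrow> q \<in> C \<Longrightarrow>
               Limsup (at_right 0) (\<lambda>t::real. ereal (f k (t *\<^sub>R q + (1 - t) *\<^sub>R v) w))
                 \<le> ereal (f k v w)"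
    and A4: "\<And>k v. k \<in> {1..K} \<Longrightarrow> v \<in> C \<Longrightarrow>
               convex_on C (f k v) \<and> lower_semicontinuous_on C (f k v)"
    and S_self: "\<And>j. j \<in> {1..N} \<Longrightarrow> S j ` C \<subseteq> C"
    and S_closed: "\<And>j. j \<in> {1..N} \<Longrightarrow> closed_operator_on C (S j)"
    and S_qne: "\<And>j. j \<in> {1..N} \<Longrightarrow> quasi_phi_nonexpansive_on C (S j)"
    and F_def: "F = (\<Inter>i\<in>{1..M}. VI (A i) C) \<inter> (\<Inter>j\<in>{1..N}. Fix (S j) C)
                      \<inter> (\<Inter>k\<in>{1..K}. EP (f k) C)"
    and F_ne: "F \<noteq> {}"
    and beta_range: "\<And>n j. j \<le> N \<Longrightarrow> 0 \<le> \<beta> n j \<and> \<beta> n j \<le> 1"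
    and beta_sum: "\<And>n. (\<Sum>j=0..N. \<beta> n j) = 1"
    and beta_liminf: "\<And>j. j \<in> {1..N} \<Longrightarrow> liminf (\<lambda>n. ereal (\<beta> n 0 * \<beta> n j)) > 0"
    and ab: "a \<in> {0 <..< \<alpha> * (convexity_c TYPE('a))\<^sup>2 / 2}"
            "b \<in> {0 <..< \<alpha> * (convexity_c TYPE('a))\<^sup>2 / 2}"
    and lam: "\<And>n. lam n \<in> {a..b}"
    and d: "d > 0"
    and r: "\<And>n. r n \<ge> d"
    and x0: "x0 \<in> C"
    and x_0: "x 0 = x0"
    and C_0: "Cn 0 = C"
    and y_step: "\<And>n i. i \<in> {1..M} \<Longrightarrow>
               y n i = gen_proj C (inv_duality_map (duality_map (x n) - lam n *\<^sub>R A i (x n)))"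
    and i_step: "\<And>n. is_arg_max (\<lambda>i. norm (y n i - x n)) (\<lambda>i. i \<in> {1..M}) (i_sel n)"
    and ybar_step: "\<And>n. ybar n = y n (i_sel n)"
    and z_step: "\<And>n. z n = inv_duality_map (\<beta> n 0 *\<^sub>R duality_map (x n)
               + (\<Sum>j=1..N. \<beta> n j *\<^sub>R duality_map (S j (ybar n))))"
    and u_step: "\<And>n k. k \<in> {1..K} \<Longrightarrow> u n k = resolvent C (f k) (r n) (z n)"
    and k_step: "\<And>n. is_arg_max (\<lambda>k. norm (u n k - x n)) (\<lambda>k. k \<in> {1..K}) (k_sel n)"
    and ubar_step: "\<And>n. ubar n = u n (k_sel n)"
    and C_step: "\<And>n. Cn (Suc n) = {v \<in> Cn n. lyapunov v (ubar n) \<le> lyapunov v (x n)}"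
    and x_step: "\<And>n. x (Suc n) = gen_proj (Cn (Suc n)) x0"
  shows "x \<longlonglongrightarrow> gen_proj F x0"
proof -
  obtain \<kappa> where "\<kappa> > 0" and "\<And>x y :: 'a. (norm ((1/2) *\<^sub>R (x + y)))\<^sup>2
      \<le> ((norm x)\<^sup>2 + (norm y)\<^sup>2) / 2 - \<kappa> * (norm (x - y))\<^sup>2"
    using midpoint_strongly_convex[OF space(2)] by blast
  then interpret smooth_convex_space "TYPE('a)" \<kappa>
    by unfold_locales (use space(1) in auto)

  \<comment> \<open>Selection rules and constants\<close>
  have eqf: "equilibrium_bifunction C (f k)" if "k \<in> {1..K}" for k
    unfolding equilibrium_bifunction_def using A1 A2 A3 A4 that by blast
  have i_sel: "i_sel n \<in> {1..M}" and i_max: "i \<in> {1..M} \<Longrightarrow> norm (y n i - x n) \<le> norm (ybar n - x n)" for n i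
    using i_step[of n] by (auto simp: is_arg_max_linorder ybar_step)
  have k_sel: "k_sel n \<in> {1..K}" and k_max: "k \<in> {1..K} \<Longrightarrow> norm (u n k - x n) \<le> norm (ubar n - x n)" for n k
    using k_step[of n] by (auto simp: is_arg_max_linorder ubar_step)
  have r_pos: "r n > 0" for n using r[of n] d by linarith
  have lam_pos: "0 < lam n" "a \<le> lam n" "lam n \<le> b" for n using lam[of n] ab(1) by auto
  define c2 where "c2 = (convexity_c TYPE('a))\<^sup>2"
  have c2: "c2 > 0" using convexity_c_props(1) by (simp add: c2_def)
  \<comment> \<open>A lower bound for \<open>2 * l * (\<alpha> - 2 * l / c2)\<close> over
    \<open>l\<close> in \<open>[a, b]\<close>, estimating the two factors separately.\<close>
  define \<theta> where "\<theta> = 2 * a * (\<alpha> - 2 * b / c2)"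
  have \<theta>_gap: "0 < \<alpha> - 2 * b / c2" using ab(2) c2 by (simp add: c2_def[symmetric] field_simps)
  then have \<theta>: "\<theta> > 0" using ab(1) by (simp add: \<theta>_def)
  have F_mem: "p \<in> C" "i \<in> {1..M} \<Longrightarrow> p \<in> VI (A i) C" "j \<in> {1..N} \<Longrightarrow> p \<in> Fix (S j) C"
    "k \<in> {1..K} \<Longrightarrow> p \<in> EP (f k) C" if "p \<in> F" for p i j k
    using that MNK unfolding F_def by (auto simp: VI_def)

  \<comment> \<open>Index 0 stands for \<open>x n\<close>, so that \<open>z n\<close> becomes a
    single mixture over \<open>0..N\<close>.\<close>
  define w where "w n j = (if j = 0 then x n else S j (ybar n))" for n j
  have Jz: "duality_map (z n) = (\<Sum>j=0..N. \<beta> n j *\<^sub>R duality_map (w n j))" for n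
    unfolding z_step by (simp add: sum.atLeast_Suc_atMost w_def cong: sum.cong_simp)
  define q where "q p n = norm (A (i_sel n) (x n) - A (i_sel n) p)" for p n

  \<comment> \<open>Decrease of the Lyapunov functional in one iteration\<close>
  have ybar_C: "ybar n \<in> C" for n
    unfolding ybar_step y_step[OF i_sel] by (rule gen_proj_mem[OF C])

  have step: "\<beta> n 0 * \<beta> n j * (\<theta> * (q p n)\<^sup>2 + lyapunov (z n) (x n) + lyapunov (z n) (S j (ybar n)))
      \<le> lyapunov p (x n) - lyapunov p (ubar n)"
    if xC: "x n \<in> C" and p: "p \<in> F" and j: "j \<in> {1..N}" for n p j
  proof -
    have ybar: "lyapunov p (ybar n) \<le> lyapunov p (x n) - \<theta> * (q p n)\<^sup>2"
    proof -
      have pVI: "p \<in> VI (A (i_sel n)) C" using F_mem(2)[OF p i_sel] .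
      have "lyapunov p (ybar n) \<le> lyapunov p (x n) - 2 * lam n * (\<alpha> - 2 * lam n / c2) * (q p n)\<^sup>2"
        unfolding ybar_step y_step[OF i_sel] q_def c2_def
        by (rule projected_gradient_step[OF C V1[OF i_sel] pVI xC V3[OF i_sel xC pVI]])
          (use lam_pos in \<open>simp add: less_imp_le\<close>)
      moreover have "\<theta> \<le> 2 * lam n * (\<alpha> - 2 * lam n / c2)"
        unfolding \<theta>_def using lam_pos[of n] \<theta>_gap c2 ab(1)
        by (intro mult_mono diff_mono divide_right_mono) auto
      then have "\<theta> * (q p n)\<^sup>2 \<le> 2 * lam n * (\<alpha> - 2 * lam n / c2) * (q p n)\<^sup>2"
        by (rule mult_right_mono) simp
      ultimately show ?thesis by linarith
    qed
    have \<beta>: "0 \<le> \<beta> n i" "\<beta> n i \<le> 1" if "i \<le> N" for i using beta_range[OF that] by auto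
    have wle: "lyapunov p (w n i) \<le> lyapunov p (x n) - (if i = 0 then 0 else \<theta> * (q p n)\<^sup>2)"
      if "i \<le> N" for i
    proof (cases "i = 0")
      case False
      then have "i \<in> {1..N}" using that by simp
      with S_qne[OF this] F_mem(3)[OF p this] ybar_C[of n]
      have "lyapunov p (S i (ybar n)) \<le> lyapunov p (ybar n)"
        by (auto simp: quasi_phi_nonexpansive_on_def)
      then show ?thesis using ybar False by (simp add: w_def)
    qed (simp add: w_def)
    have q0: "0 \<le> \<theta> * (q p n)\<^sup>2" using \<theta> by simp
    \<comment> \<open>All \<open>t i\<close> are nonnegative and by \<open>lyapunov_mixture\<close>
      they sum to \<open>lyapunov p (x n) - lyapunov p (z n)\<close>. Only indices 0 and
      \<open>j\<close> are kept; lowering their weights to the product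
      \<open>\<beta> n 0 * \<beta> n j\<close> gives the quantity controlled by
      \<open>beta_liminf\<close>.\<close>
    define t where "t i = \<beta> n i * (lyapunov p (x n) - lyapunov p (w n i) + lyapunov (z n) (w n i))" for i
    have t_lower: "\<beta> n i * ((if i = 0 then 0 else \<theta> * (q p n)\<^sup>2) + lyapunov (z n) (w n i)) \<le> t i"
      if "i \<le> N" for i
      unfolding t_def using wle[OF that] \<beta>[OF that] by (intro mult_left_mono) auto
    have t_nonneg: "0 \<le> t i" if "i \<le> N" for i
    proof (rule order_trans[OF _ t_lower[OF that]])
      show "0 \<le> \<beta> n i * ((if i = 0 then 0 else \<theta> * (q p n)\<^sup>2) + lyapunov (z n) (w n i))"
        using \<beta>[OF that] q0 lyapunov_nonneg by simp
    qed
    have "t 0 + t j = (\<Sum>i\<in>{0, j}. t i)" using j by simp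
    also have "\<dots> \<le> (\<Sum>i=0..N. t i)" using j t_nonneg by (intro sum_mono2) auto
    also have "\<dots> = (\<Sum>i=0..N. \<beta> n i) * lyapunov p (x n)
        - (\<Sum>i=0..N. \<beta> n i * (lyapunov p (w n i) - lyapunov (z n) (w n i)))"
      unfolding t_def sum_distrib_right sum_subtractf[symmetric]
      by (intro sum.cong) (auto simp: algebra_simps)
    also have "\<dots> = lyapunov p (x n) - lyapunov p (z n)"
      using lyapunov_mixture[OF beta_sum Jz, where p = p] beta_sum by simp
    also have "\<dots> \<le> lyapunov p (x n) - lyapunov p (ubar n)"
      unfolding ubar_step u_step[OF k_sel]
      using resolvent_lyapunov[OF C eqf[OF k_sel] r_pos F_mem(4)[OF p k_sel]] by simp
    finally have sum: "t 0 + t j \<le> lyapunov p (x n) - lyapunov p (ubar n)" .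
    have j': "j \<noteq> 0" "j \<le> N" using j by auto
    have "\<beta> n 0 * \<beta> n j * (\<theta> * (q p n)\<^sup>2 + lyapunov (z n) (x n) + lyapunov (z n) (S j (ybar n)))
        = \<beta> n 0 * \<beta> n j * lyapunov (z n) (x n)
          + \<beta> n 0 * \<beta> n j * (\<theta> * (q p n)\<^sup>2 + lyapunov (z n) (S j (ybar n)))"
      by (simp add: algebra_simps)
    also have "\<dots> \<le> \<beta> n 0 * lyapunov (z n) (x n)
        + \<beta> n j * (\<theta> * (q p n)\<^sup>2 + lyapunov (z n) (S j (ybar n)))"
      using \<beta>[of 0] \<beta>[OF j'(2)] q0 lyapunov_nonneg
      by (intro add_mono mult_right_mono) (auto intro: mult_left_le mult_left_le_one_le)
    also have "\<dots> \<le> t 0 + t j"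
      using t_lower[of 0] t_lower[OF j'(2)] j' by (simp add: w_def)
    also note sum
    finally show ?thesis .
  qed

  \<comment> \<open>The shrinking sets and their projections\<close>
  have inv: "Cn n \<subseteq> C \<and> closed (Cn n) \<and> convex (Cn n) \<and> F \<subseteq> Cn n \<and> x n = gen_proj (Cn n) x0" for n
  \<comment> \<open>The claims must be carried together: \<open>x n\<close> in \<open>C\<close> is
    needed for \<open>step\<close>, which puts \<open>F\<close> into the next set and thereby makes
    it nonempty for the next projection.\<close>
  proof (induction n)
    case 0
    have "gen_proj C x0 = x0" by (rule gen_proj_eqI[OF x0]) (simp add: lyapunov_self)
    then show ?case using C F_mem(1) by (auto simp: C_0 x_0)
  next
    case (Suc n)
    then have IH: "Cn n \<subseteq> C" "closed (Cn n)" "convex (Cn n)" "F \<subseteq> Cn n" "x n = gen_proj (Cn n) x0"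
      by auto
    have "Cn n \<noteq> {}" using IH(4) F_ne by auto
    then have xC: "x n \<in> C" using gen_proj_mem[OF _ IH(2,3), of x0] IH(1,5) by auto
    have eq: "Cn (Suc n) = Cn n \<inter> {v. lyapunov v (ubar n) \<le> lyapunov v (x n)}"
      using C_step by blast
    have "lyapunov p (ubar n) \<le> lyapunov p (x n)" if p: "p \<in> F" for p
    proof -
      have j: "1 \<in> {1..N}" using MNK by simp
      have "0 \<le> \<beta> n 0 * \<beta> n 1 * (\<theta> * (q p n)\<^sup>2 + lyapunov (z n) (x n) + lyapunov (z n) (S 1 (ybar n)))"
        using beta_range[of 0 n] beta_range[of 1 n] MNK \<theta> lyapunov_nonneg
        by (intro mult_nonneg_nonneg add_nonneg_nonneg) auto
      then show ?thesis using step[OF xC p j] by linarith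
    qed
    then show ?case
      using IH lyapunov_le_halfspace by (auto simp: eq x_step intro: closed_Int convex_Int)
  qed
  have Cn: "Cn n \<subseteq> C" "closed (Cn n)" "convex (Cn n)" "F \<subseteq> Cn n" "x n = gen_proj (Cn n) x0" "Cn n \<noteq> {}" for n
    using inv[of n] F_ne by auto
  have x_mem: "x n \<in> Cn n" for n using gen_proj_mem[OF Cn(6,2,3), of n x0] Cn(5) by simp
  have xC: "x n \<in> C" for n using x_mem Cn(1) by blast
  have x_proj: "lyapunov v (x n) + lyapunov (x n) x0 \<le> lyapunov v x0" if "v \<in> Cn n" for v n
    using gen_proj_lyapunov[OF Cn(6,2,3) that, of x0] Cn(5) by simp
  have Cn_anti: "Cn n \<subseteq> Cn m" if "m \<le> n" for m n
    using that by (induction rule: dec_induct) (auto simp: C_step)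

  \<comment> \<open>Convergence of the iterates\<close>
  obtain p where p: "p \<in> F" using F_ne by blast
  define h where "h n = lyapunov (x n) x0" for n
  \<comment> \<open>Later iterates lie in earlier sets, so the increase of \<open>h\<close> bounds
    the Lyapunov distance between iterates.\<close>
  have h_step: "lyapunov (x n) (x m) + h m \<le> h n" if "m \<le> n" for m n
    unfolding h_def using x_proj[of "x n" m] x_mem[of n] Cn_anti[OF that] by blast
  have "incseq h"
    by (intro incseq_SucI) (use h_step lyapunov_nonneg in \<open>smt (verit) le_SucI order_refl\<close>)
  moreover have "h n \<le> lyapunov p x0" for n
    using x_proj[OF subsetD[OF Cn(4) p], of n] lyapunov_nonneg[of p "x n"] by (simp add: h_def)
  ultimately have "\<exists>l. h \<longlonglongrightarrow> l \<and> (\<forall>n. h n \<le> l)"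
    by (meson incseq_convergent)
  then obtain l where l: "h \<longlonglongrightarrow> l" "\<And>n. h n \<le> l" by blast
  have gap: "(\<lambda>n. l - h n) \<longlonglongrightarrow> 0" using tendsto_diff[OF tendsto_const[of l] l(1)] by simp
  have x_near: "lyapunov (x n) (x m) \<le> l - h m" if "m \<le> n" for m n
    using h_step[OF that] l(2)[of n] by linarith
  have "Cauchy x"
  proof (rule Cauchy_if_square_bounded[OF _ _ gap])
    show "2 * \<kappa> > 0" using \<kappa>_pos by simp
    show "2 * \<kappa> * (norm (x m - x n))\<^sup>2 \<le> l - h m" if "m \<le> n" for m n
      using lyapunov_ge[of "x n" "x m"] x_near[OF that] by (simp add: norm_minus_commute)
  qed
  then obtain xs where xs: "x \<longlonglongrightarrow> xs" by (auto simp: Cauchy_convergent_iff convergent_def)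
  have xsC: "xs \<in> C" using closed_sequentially[OF C(2) xC xs] .

  \<comment> \<open>Common limit of the auxiliary sequences\<close>
  have close: "Y \<longlonglongrightarrow> xs" if "(\<lambda>n. X n - Y n) \<longlonglongrightarrow> 0" "X \<longlonglongrightarrow> xs" for X Y :: "nat \<Rightarrow> 'a"
    using tendsto_diff[OF that(2,1)] by simp
  \<comment> \<open>This transfers convergence from the index chosen by the arg max to every other
    index.\<close>
  have dominated: "Y \<longlonglongrightarrow> xs" if "\<And>n. norm (Y n - x n) \<le> norm (Y' n - x n)" "Y' \<longlonglongrightarrow> xs"
    for Y Y' :: "nat \<Rightarrow> 'a"
  proof (rule close[OF _ xs])
    have "(\<lambda>n. norm (Y' n - x n)) \<longlonglongrightarrow> 0" using tendsto_norm[OF tendsto_diff[OF that(2) xs]] by simp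
    then show "(\<lambda>n. x n - Y n) \<longlonglongrightarrow> 0"
      by (rule Lim_null_comparison[rotated]) (use that(1) in \<open>simp add: norm_minus_commute\<close>)
  qed

  have ubar: "ubar \<longlonglongrightarrow> xs"
  proof (rule close)
    \<comment> \<open>Membership of \<open>x (Suc n)\<close> in \<open>Cn (Suc n)\<close> replaces
      \<open>ubar n\<close> by \<open>x n\<close>.\<close>
    have "lyapunov (x (Suc n)) (ubar n) \<le> l - h n" for n
      using x_mem[of "Suc n"] x_near[of n "Suc n"] unfolding C_step by auto
    then have "(\<lambda>n. lyapunov (x (Suc n)) (ubar n)) \<longlonglongrightarrow> 0"
      using lyapunov_nonneg by (intro tendsto_sandwich[OF _ _ tendsto_const gap]) auto
    then show "(\<lambda>n. x (Suc n) - ubar n) \<longlonglongrightarrow> 0" by (rule diff_tendsto_0_if_lyapunov)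
    show "(\<lambda>n. x (Suc n)) \<longlonglongrightarrow> xs" using xs by (rule LIMSEQ_Suc)
  qed
  have u_lim: "(\<lambda>n. u n k) \<longlonglongrightarrow> xs" if "k \<in> {1..K}" for k
    by (rule dominated[OF k_max[OF that] ubar])

  have decrease: "(\<lambda>n. lyapunov p (x n) - lyapunov p (ubar n)) \<longlonglongrightarrow> 0"
    using tendsto_diff[OF tendsto_lyapunov[OF tendsto_const[of p] xs]
        tendsto_lyapunov[OF tendsto_const[of p] ubar]]
    by simp
  have residual: "(\<lambda>n. \<theta> * (q p n)\<^sup>2 + lyapunov (z n) (x n) + lyapunov (z n) (S j (ybar n))) \<longlonglongrightarrow> 0"
    (is "?R \<longlonglongrightarrow> 0") if j: "j \<in> {1..N}" for j
  proof -
    \<comment> \<open>Eventually the product of weights exceeds \<open>\<mu> > 0\<close>, so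
      division by \<open>\<mu>\<close> removes it from \<open>step\<close>.\<close>
    obtain \<mu> where \<mu>: "0 < ereal \<mu>" "ereal \<mu> < liminf (\<lambda>n. ereal (\<beta> n 0 * \<beta> n j))"
      using ereal_dense2[OF beta_liminf[OF j]] by blast
    have R: "0 \<le> ?R n" for n using \<theta> lyapunov_nonneg by (intro add_nonneg_nonneg) auto
    have "\<forall>\<^sub>F n in sequentially. norm (?R n) \<le> (lyapunov p (x n) - lyapunov p (ubar n)) / \<mu>"
      using less_LiminfD[OF \<mu>(2)]
    proof eventually_elim
      case (elim n)
      then have "\<mu> * ?R n \<le> \<beta> n 0 * \<beta> n j * ?R n" using R by (intro mult_right_mono) auto
      also have "\<dots> \<le> lyapunov p (x n) - lyapunov p (ubar n)" by (rule step[OF xC p j])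
      finally show ?case using \<mu>(1) R[of n] by (simp add: pos_le_divide_eq mult.commute)
    qed
    moreover have "(\<lambda>n. (lyapunov p (x n) - lyapunov p (ubar n)) / \<mu>) \<longlonglongrightarrow> 0"
      using tendsto_divide[OF decrease tendsto_const[of \<mu>]] \<mu>(1) by simp
    ultimately show ?thesis by (rule Lim_null_comparison)
  qed
  have part: "X \<longlonglongrightarrow> 0" if "j \<in> {1..N}" "\<And>n. 0 \<le> X n"
    "\<And>n. X n \<le> \<theta> * (q p n)\<^sup>2 + lyapunov (z n) (x n) + lyapunov (z n) (S j (ybar n))" for X j
    using that(2,3) by (intro tendsto_sandwich[OF _ _ tendsto_const residual[OF that(1)]]) auto
  have one: "1 \<in> {1..N}" using MNK by simp
  have "(\<lambda>n. \<theta> * (q p n)\<^sup>2) \<longlonglongrightarrow> 0"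
    by (rule part[OF one]) (use \<theta> lyapunov_nonneg in \<open>auto simp: add.assoc\<close>)
  from tendsto_real_sqrt[OF tendsto_divide[OF this tendsto_const[of \<theta>]]]
  have q_lim: "q p \<longlonglongrightarrow> 0" using \<theta> by (simp add: q_def[abs_def])
  have "(\<lambda>n. lyapunov (z n) (x n)) \<longlonglongrightarrow> 0"
    by (rule part[OF one]) (use \<theta> lyapunov_nonneg in auto)
  from tendsto_minus[OF diff_tendsto_0_if_lyapunov[OF this]]
  have "(\<lambda>n. x n - z n) \<longlonglongrightarrow> 0" by simp
  then have z_lim: "z \<longlonglongrightarrow> xs" by (rule close[OF _ xs])
  have S_lim: "(\<lambda>n. S j (ybar n)) \<longlonglongrightarrow> xs" if j: "j \<in> {1..N}" for j
  proof (rule close[OF diff_tendsto_0_if_lyapunov z_lim])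
    show "(\<lambda>n. lyapunov (z n) (S j (ybar n))) \<longlonglongrightarrow> 0"
      by (rule part[OF j]) (use \<theta> lyapunov_nonneg in auto)
  qed

  have ybar_lim: "ybar \<longlonglongrightarrow> xs"
  proof (rule close[OF _ xs])
    \<comment> \<open>The gradient step before projection. (V3) bounds its displacement by a
      multiple of \<open>q p n\<close>; since \<open>x n\<close> lies in \<open>C\<close>,
      projecting does not increase the Lyapunov distance from \<open>x n\<close>.\<close>
    define v where "v n = inv_duality_map (duality_map (x n) - lam n *\<^sub>R A (i_sel n) (x n))" for n
    have le: "norm (x n - v n) \<le> 2 / c2 * (b * q p n)" for n
    proof -
      have "norm (v n - x n) \<le> 2 / c2 * (\<bar>lam n\<bar> * norm (A (i_sel n) (x n)))"
        unfolding v_def c2_def by (rule gradient_step_diff)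
      also have "\<dots> \<le> 2 / c2 * (b * q p n)"
        unfolding q_def using lam_pos[of n] c2 V3[OF i_sel xC F_mem(2)[OF p i_sel]]
        by (intro mult_left_mono mult_mono) auto
      finally show ?thesis by (simp add: norm_minus_commute)
    qed
    have "(\<lambda>n. 2 / c2 * (b * q p n)) \<longlonglongrightarrow> 2 / c2 * (b * 0)" by (intro tendsto_intros q_lim)
    then have "(\<lambda>n. x n - v n) \<longlonglongrightarrow> 0"
      using le by (intro Lim_null_comparison[of "\<lambda>n. x n - v n"]) auto
    from tendsto_lyapunov[OF xs close[OF this xs]]
    have lim: "(\<lambda>n. lyapunov (x n) (v n)) \<longlonglongrightarrow> 0" by (simp add: lyapunov_self)
    have "lyapunov (x n) (ybar n) \<le> lyapunov (x n) (v n)" for n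
      using gen_proj_lyapunov[OF C xC, of n "v n"] lyapunov_nonneg[of "gen_proj C (v n)" "v n"]
      unfolding ybar_step y_step[OF i_sel] v_def by linarith
    then have "(\<lambda>n. lyapunov (x n) (ybar n)) \<longlonglongrightarrow> 0"
      using lyapunov_nonneg by (intro tendsto_sandwich[OF _ _ tendsto_const lim]) auto
    then show "(\<lambda>n. x n - ybar n) \<longlonglongrightarrow> 0" by (rule diff_tendsto_0_if_lyapunov)
  qed

  \<comment> \<open>The limit lies in \<open>F\<close>\<close>
  have "xs \<in> VI (A i) C" if i: "i \<in> {1..M}" for i
  proof -
    have y_lim: "(\<lambda>n. y n i) \<longlonglongrightarrow> xs" by (rule dominated[OF i_max[OF i] ybar_lim])
    have A_lim: "(\<lambda>n. A i (x n)) \<longlonglongrightarrow> A i xs"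
      by (rule inverse_strongly_monotone_tendsto[OF V1[OF i] alpha xs xC xsC])
    have "0 \<le> blinfun_apply (A i xs) (v - xs)" if v: "v \<in> C" for v
    proof (rule LIMSEQ_le)
      \<comment> \<open>The variational inequality of the projection divided by
        \<open>lam n\<close>; \<open>lam n \<ge> a\<close> keeps the error under control.\<close>
      let ?e = "\<lambda>n. blinfun_apply (duality_map (x n) - duality_map (y n i)) (v - y n i)"
      have "(\<lambda>n. - (\<bar>?e n\<bar> / a)) \<longlonglongrightarrow> - (\<bar>blinfun_apply (duality_map xs - duality_map xs) (v - xs)\<bar> / a)"
        using ab(1) by (intro tendsto_intros blinfun.tendsto tendsto_duality_map xs y_lim) auto
      then show "(\<lambda>n. - (\<bar>?e n\<bar> / a)) \<longlonglongrightarrow> 0" by simp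
      show "(\<lambda>n. blinfun_apply (A i (x n)) (v - y n i)) \<longlonglongrightarrow> blinfun_apply (A i xs) (v - xs)"
        by (intro tendsto_intros blinfun.tendsto A_lim y_lim)
      have "- (\<bar>?e n\<bar> / a) \<le> blinfun_apply (A i (x n)) (v - y n i)" for n
      proof -
        have "?e n \<le> lam n * blinfun_apply (A i (x n)) (v - y n i)"
          using gen_proj_variational[OF C v, of "inv_duality_map (duality_map (x n) - lam n *\<^sub>R A i (x n))"]
          unfolding y_step[OF i, symmetric] by (simp add: blinfun.diff_left blinfun.scaleR_left)
        then have "?e n / lam n \<le> blinfun_apply (A i (x n)) (v - y n i)"
          using lam_pos[of n] by (simp add: pos_divide_le_eq mult.commute)
        moreover have "\<bar>?e n\<bar> / lam n \<le> \<bar>?e n\<bar> / a"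
          using lam_pos[of n] ab(1) by (intro divide_left_mono) auto
        moreover have "- (\<bar>?e n\<bar> / lam n) \<le> ?e n / lam n"
          using lam_pos[of n] by (simp add: field_simps)
        ultimately show ?thesis by linarith
      qed
      then show "\<exists>N. \<forall>n\<ge>N. - (\<bar>?e n\<bar> / a) \<le> blinfun_apply (A i (x n)) (v - y n i)" by blast
    qed
    then show ?thesis using xsC by (simp add: VI_def)
  qed
  moreover have "xs \<in> Fix (S j) C" if j: "j \<in> {1..N}" for j
    using S_closed[OF j] ybar_C ybar_lim S_lim[OF j] xsC
    unfolding closed_operator_on_def Fix_def by blast
  moreover have "xs \<in> EP (f k) C" if k: "k \<in> {1..K}" for k
  proof -
    note fk = equilibrium_bifunctionD[OF eqf[OF k]]
    have uC: "u n k \<in> C" for n unfolding u_step[OF k] by (rule resolvent_mem[OF C eqf[OF k] r_pos])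
    have le0: "f k v xs \<le> 0" if v: "v \<in> C" for v
    proof (rule lsc_le_limit[OF fk(4)[OF v] xsC u_lim[OF k] uC])
      \<comment> \<open>By (A2) the resolvent inequality bounds \<open>f k v (u n k)\<close> by an
        error that vanishes since \<open>u n k\<close> and \<open>z n\<close> share the limit and
        \<open>r n \<ge> d\<close>. Semicontinuity then gives the dual inequality that
        \<open>minty\<close> inverts.\<close>
      let ?e = "\<lambda>n. blinfun_apply (duality_map (u n k) - duality_map (z n)) (v - u n k)"
      show "f k v (u n k) \<le> \<bar>?e n\<bar> / d" for n
      proof -
        have "0 \<le> f k (u n k) v + (1 / r n) * ?e n"
          unfolding u_step[OF k] by (rule resolvent_equilibrium[OF C eqf[OF k] r_pos v])
        moreover have "(1 / r n) * ?e n \<le> \<bar>?e n\<bar> / r n"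
          using r_pos[of n] by (simp add: divide_right_mono)
        moreover have "\<bar>?e n\<bar> / r n \<le> \<bar>?e n\<bar> / d"
          using r[of n] r_pos[of n] d by (intro divide_left_mono) auto
        ultimately show ?thesis using fk(2)[OF v uC] by (smt (verit))
      qed
      have "(\<lambda>n. \<bar>?e n\<bar> / d) \<longlonglongrightarrow> \<bar>blinfun_apply (duality_map xs - duality_map xs) (v - xs)\<bar> / d"
        using d by (intro tendsto_intros blinfun.tendsto tendsto_duality_map u_lim[OF k] z_lim) auto
      then show "(\<lambda>n. \<bar>?e n\<bar> / d) \<longlonglongrightarrow> 0" by simp
    qed
    have "0 \<le> f k xs v" if v: "v \<in> C" for v
      using minty[OF eqf[OF k] convex_on_const[THEN iffD2, OF C(3)] xsC _ v, of 0] le0 by simp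
    then show ?thesis using xsC by (simp add: EP_def)
  qed
  ultimately have xsF: "xs \<in> F" unfolding F_def by blast

  \<comment> \<open>Identification of the limit\<close>
  have "gen_proj F x0 = xs"
  proof (rule gen_proj_eqI[OF xsF])
    fix v assume v: "v \<in> F"
    \<comment> \<open>Every \<open>v\<close> in \<open>F\<close> lies in all \<open>Cn n\<close>, so
      the projection inequality \<open>x_proj\<close> passes to the limit in the form required by
      \<open>gen_proj_eqI\<close>.\<close>
    have "(\<lambda>n. lyapunov v (x n) + lyapunov (x n) x0) \<longlonglongrightarrow> lyapunov v xs + lyapunov xs x0"
      by (intro tendsto_intros tendsto_lyapunov xs)
    then show "lyapunov v xs + lyapunov xs x0 \<le> lyapunov v x0"
      by (rule LIMSEQ_le_const2) (use x_proj v Cn(4) in blast)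
  qed
  then show ?thesis using xs by simp
qed

end
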